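(* Let $n,m,b\in\mathbb{Z}$ with $n\ge 3$, $|m|\ge 2$ and $b\ge 2$. Assume that $\gcd(b,m)=1$ and that $b$ is squarefree. Let $$\mathcal{D}:=\frac{n^n(1-bm^{2n})^{n+1}+bm^{2n}(n+1)^{n+1}}{(1+bm^{2n}n)^2}\in\mathbb{Z},$$ and assume that $$d:=\frac{|\mathcal{D}|}{\prod_{p\text{ prime},\ p\mid bm}p^{\nu_p(\mathcal{D})}}$$ is squarefree. Then the polynomial $$\mathcal{F}_{n,b,m,1}(x)=x^n+b\sum_{j=1}^{n}(m^2x)^{n-j}$$ is monogenic if and only if both of the following hold: (1) no odd prime divisor of $\gcd(n,m)$ is a base-$b$ Wieferich prime; and (2) if $\gcd(n,m)\equiv 0\pmod 2$, then $b\equiv 1\pmod 4$ (equivalently, $2$ is a base-$b$ Wieferich prime).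
   Context: For an integer $b\ge 2$, a prime $p\ge 2$ is called a base-$b$ Wieferich prime if $b^{p-1}\equiv 1\pmod{p^2}$. A monic polynomial $f(x)\in\mathbb{Z}[x]$ is called monogenic if $f(x)$ is irreducible over $\mathbb{Q}$ and $\{1,\theta,\theta^2,\ldots,\theta^{\deg(f)-1}\}$ is a basis (over $\mathbb{Z}$) for the ring of integers of $\mathbb{Q}(\theta)$, where $f(\theta)=0$. Here $\nu_p(z)$ denotes the $p$-adic valuation of the integer $z$. The quantity $\mathcal{D}$ is always an integer. In the sum, the term $j=n$ is $(m^2x)^0=1$. *)

theory Defs
  imports
    "HOL-Computational_Algebra.Computational_Algebra"
    "HOL-Number_Theory.Cong"
begin

definition wieferich_prime :: "int \<Rightarrow> nat \<Rightarrow> bool" where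
  "wieferich_prime b p \<longleftrightarrow> prime p \<and> [b ^ (p - 1) = 1] (mod (int p)\<^sup>2)"

lemma wieferich_prime_2_iff: "wieferich_prime b 2 \<longleftrightarrow> [b = 1] (mod 4)"
  by (simp add: wieferich_prime_def)


text \<open>The field $\mathbb{Q}(\theta)$ for a complex number $\theta$, as the smallest subfield
  of $\mathbb{C}$ containing $\theta$. Closure under negation follows from \<open>diff\<close>, and
  \<open>inv\<close> is harmless at $0$ because there \<open>inverse 0 = 0\<close>.\<close>

inductive_set rat_adjoin :: "complex \<Rightarrow> complex set" for \<theta> :: complex where
  rat: "of_rat q \<in> rat_adjoin \<theta>"
| gen: "\<theta> \<in> rat_adjoin \<theta>"
| add: "x \<in> rat_adjoin \<theta> \<Longrightarrow> y \<in> rat_adjoin \<theta> \<Longrightarrow> x + y \<in> rat_adjoin \<theta>"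
| diff: "x \<in> rat_adjoin \<theta> \<Longrightarrow> y \<in> rat_adjoin \<theta> \<Longrightarrow> x - y \<in> rat_adjoin \<theta>"
| mult: "x \<in> rat_adjoin \<theta> \<Longrightarrow> y \<in> rat_adjoin \<theta> \<Longrightarrow> x * y \<in> rat_adjoin \<theta>"
| inv: "x \<in> rat_adjoin \<theta> \<Longrightarrow> inverse x \<in> rat_adjoin \<theta>"

definition ring_of_integers :: "complex set \<Rightarrow> complex set" where
  "ring_of_integers K = {z \<in> K. algebraic_int z}"

interpretation int_module: module "\<lambda>(k::int) (z::complex). of_int k * z"
  by unfold_locales (simp_all add: algebra_simps)

definition is_int_basis :: "complex set \<Rightarrow> complex set \<Rightarrow> bool" where
  "is_int_basis B M \<longleftrightarrow> int_module.independent B \<and> int_module.span B = M"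

text \<open>The condition is imposed for every complex root $\theta$. There is one, since an irreducible
  polynomial is not constant; the roots are conjugate, so the choice of $\theta$ is immaterial.
  For irreducible $f$ the powers of $\theta$ below are pairwise distinct, so that passing from
  the family to the set loses nothing.\<close>

definition monogenic :: "int poly \<Rightarrow> bool" where
  "monogenic f \<longleftrightarrow>
     lead_coeff f = 1 \<and>
     irreducible (map_poly rat_of_int f) \<and>
     (\<forall>\<theta>::complex. poly (map_poly of_int f) \<theta> = 0 \<longrightarrow>
        is_int_basis ((\<lambda>i. \<theta> ^ i) ` {..<degree f}) (ring_of_integers (rat_adjoin \<theta>)))"


definition F_poly :: "nat \<Rightarrow> int \<Rightarrow> int \<Rightarrow> int poly" where
  "F_poly n b m = monom 1 n + smult b (\<Sum>j=1..n. [:0, m\<^sup>2:] ^ (n - j))"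

text \<open>The divisions on \<^typ>\<open>int\<close> in the next two definitions are exact, see
  \<open>of_int_D_quot\<close> and \<open>of_int_d_quot\<close>.\<close>

definition D_quot :: "nat \<Rightarrow> int \<Rightarrow> int \<Rightarrow> int" where
  "D_quot n b m =
     (int n ^ n * (1 - b * m ^ (2 * n)) ^ (n + 1) + b * m ^ (2 * n) * (int n + 1) ^ (n + 1))
       div (1 + b * m ^ (2 * n) * int n)\<^sup>2"

definition d_quot :: "nat \<Rightarrow> int \<Rightarrow> int \<Rightarrow> int" where
  "d_quot n b m =
     \<bar>D_quot n b m\<bar> div (\<Prod>p\<in>prime_factors (b * m). p ^ multiplicity p (D_quot n b m))"

lemma one_minus_power_cong:
  fixes u a :: int
  shows "u\<^sup>2 dvd (a - u) ^ k - (a ^ k - int k * a ^ (k - 1) * u)"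
proof (induction k)
  case 0
  show ?case by simp
next
  case (Suc k)
  then obtain t where t: "(a - u) ^ k - (a ^ k - int k * a ^ (k - 1) * u) = u\<^sup>2 * t"
    by (auto simp: dvd_def)
  have 1: "(a - u) ^ k = a ^ k - int k * a ^ (k - 1) * u + u\<^sup>2 * t"
    using t by simp
  have 2: "int k * a ^ k = int k * a ^ (k - 1) * a"
    by (cases k) auto
  have "(a - u) ^ Suc k - (a ^ Suc k - int (Suc k) * a ^ (Suc k - 1) * u)
      = u\<^sup>2 * (int k * a ^ (k - 1) + t * (a - u))"
    using 2 by (simp add: 1 algebra_simps power2_eq_square)
  then show ?case by (metis dvd_triv_left)
qed

lemma D_quot_dvd:
  fixes c :: int
  shows "(1 + c * int n)\<^sup>2 dvd int n ^ n * (1 - c) ^ (n + 1) + c * (int n + 1) ^ (n + 1)"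
proof -
  define u where "u = 1 + c * int n"
  let ?N = "int n ^ n * (1 - c) ^ (n + 1) + c * (int n + 1) ^ (n + 1)"
  have "int n * (1 - c) = (int n + 1) - u"
    by (simp add: u_def algebra_simps)
  then have e: "int n ^ (n + 1) * (1 - c) ^ (n + 1) = ((int n + 1) - u) ^ (n + 1)"
    by (metis power_mult_distrib)
  have uc: "int n * c = u - 1" by (simp add: u_def)
  have "int n * ?N = int n ^ (n + 1) * (1 - c) ^ (n + 1) + (int n * c) * (int n + 1) ^ (n + 1)"
    by (simp add: algebra_simps)
  also have "\<dots> = ((int n + 1) - u) ^ (n + 1)
      - ((int n + 1) ^ (n + 1) - int (n + 1) * (int n + 1) ^ (n + 1 - 1) * u)"
    unfolding e uc by (simp add: algebra_simps)
  finally have "u\<^sup>2 dvd int n * ?N"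
    using one_minus_power_cong[of u "int n + 1" "n + 1"] by simp
  moreover have "coprime (u\<^sup>2) (int n)"
  proof -
    have "coprime u (int n)"
      unfolding u_def by (metis coprime_1_left coprime_iff_gcd_eq_1 gcd_add_mult mult.commute
          gcd.commute add.commute)
    then show ?thesis by simp
  qed
  ultimately show ?thesis
    unfolding u_def by (simp add: coprime_dvd_mult_right_iff)
qed

lemma of_int_D_quot:
  "real_of_int (D_quot n b m) =
     (real n ^ n * (1 - of_int b * of_int m ^ (2 * n)) ^ (n + 1)
        + of_int b * of_int m ^ (2 * n) * (real n + 1) ^ (n + 1))
       / (1 + of_int b * of_int m ^ (2 * n) * real n)\<^sup>2"
  unfolding D_quot_def
  by (subst real_of_int_div[OF D_quot_dvd]) simp

lemma prime_part_dvd: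
  fixes a x :: int
  shows "(\<Prod>p\<in>prime_factors a. p ^ multiplicity p x) dvd \<bar>x\<bar>"
proof -
  have "finite A \<Longrightarrow> (\<And>p. p \<in> A \<Longrightarrow> prime p) \<Longrightarrow> (\<Prod>p\<in>A. p ^ multiplicity p x) dvd x"
    for A :: "int set"
  proof (induction A rule: finite_induct)
    case empty
    show ?case by simp
  next
    case (insert q A)
    have "coprime (q ^ multiplicity q x) (\<Prod>p\<in>A. p ^ multiplicity p x)"
    proof (rule prod_coprime_right)
      fix p assume "p \<in> A"
      then have "coprime q p"
        using insert by (intro primes_coprime) auto
      then show "coprime (q ^ multiplicity q x) (p ^ multiplicity p x)" by simp
    qed
    then have "q ^ multiplicity q x * (\<Prod>p\<in>A. p ^ multiplicity p x) dvd x"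
      using insert by (intro divides_mult multiplicity_dvd) auto
    then show ?case using insert by simp
  qed
  from this[of "prime_factors a"] show ?thesis by auto
qed

lemma of_int_d_quot:
  "real_of_int (d_quot n b m) =
     \<bar>of_int (D_quot n b m)\<bar>
       / (\<Prod>p\<in>prime_factors (b * m). of_int p ^ multiplicity p (D_quot n b m))"
  unfolding d_quot_def
  by (subst real_of_int_div[OF prime_part_dvd]) simp

end

theory Submission
  imports
    Defs
    "HOL-Number_Theory.Residues"
    "Jordan_Normal_Form.Char_Poly"
    "Berlekamp_Zassenhaus.Factor_Bound"
begin

text \<open>
  The polynomial $F$ is Eisenstein at every prime divisor of the squarefree number $b$, hence
  irreducible. By Dedekind's criterion, $\mathbb{Z}[\theta]$ is the full ring of integers if $F$ lies
  in no square $P^2$ of a prime ideal $P = (p, \pi)$ of $\mathbb{Z}[x]$. If $p \mid b$, then $x \in P$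
  and $F \in P^2$ forces $p^2 \mid F(0) = b$. If $p \nmid bm$, the trinomial
  $(m^2x - 1)F = m^2 x^{n+1} + (bm^{2n} - 1) x^n - b$ and its derivative show that $F \in P^2$ forces
  $p^2 \mid \mathcal{D}$, against the squarefreeness of $d$. If $p \mid m$, then
  $F \equiv x^n + b$ modulo $p^2$, which is separable modulo $p$ for $p \nmid n$. For $p \mid n$ put
  $s = x^{n/p} + b$; then $F \equiv s^p$ modulo $p$ and
  $F \equiv (-b)^p + b$ modulo $(p, s)^2$, so $F \in P^2$ forces $p^2 \mid (-b)^p + b$. Conversely,
  under that divisibility $s(\theta)^{p-1}/p$ is an algebraic integer outside $\mathbb{Z}[\theta]$.
\<close>

text \<open>Testing F against the prime ideals P = (p, \<pi>) avoids factoring it modulo p: every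
  case derives only memberships in P and P^2, and since P^2 meets Z in p^2 Z, it ends in a
  divisibility between integers. The delicate case is p prime to b m. Eliminating x between the
  trinomial and its derivative gives p^2 | N, where N = u^2 D is the numerator defining D and u = 1
  + b m^(2n) n. The factor u^2 comes from the auxiliary factor m^2 x - 1: up to a power of m^2, u is
  the value of F at 1/m^2. So p^2 | N says nothing about D when p | u. If moreover p | n + 1, a
  binomial expansion of N still yields p^2 | D, using n >= 3; otherwise m^2 x - 1 lies in P itself
  and the second derivative of the trinomial gives a contradiction.\<close>

hide_const (open) up_ring.coeff up_ring.monom module.smult comm_monoid_mult_class.coprime

section \<open>Ideals with two generators\<close>

text \<open>Membership is an explicit equation, so memberships can be proved and used by naming
  coefficients. Besides (p, \<pi>), the ideals (p^j, f) are also of this shape.\<close>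

definition ideal2 :: "'a::comm_ring_1 \<Rightarrow> 'a \<Rightarrow> 'a set" where
  "ideal2 a b = {a * x + b * y | x y. True}"

definition ideal2_sq :: "'a::comm_ring_1 \<Rightarrow> 'a \<Rightarrow> 'a set" where
  "ideal2_sq a b = {a\<^sup>2 * x + a * b * y + b\<^sup>2 * z | x y z. True}"

definition prime_ideal2 :: "'a::comm_ring_1 \<Rightarrow> 'a \<Rightarrow> bool" where
  "prime_ideal2 a b \<longleftrightarrow> 1 \<notin> ideal2 a b \<and>
     (\<forall>x y. x * y \<in> ideal2 a b \<longrightarrow> x \<in> ideal2 a b \<or> y \<in> ideal2 a b)"

lemma ideal2I: "z = a * x + b * y \<Longrightarrow> z \<in> ideal2 a b"
  unfolding ideal2_def by blast

lemma ideal2E: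
  assumes "z \<in> ideal2 a b" obtains x y where "z = a * x + b * y"
  using assms unfolding ideal2_def by blast

lemma ideal2_gen1 [simp]: "a * x \<in> ideal2 a b" by (rule ideal2I[of _ _ x _ 0]) simp
lemma ideal2_gen2 [simp]: "b * x \<in> ideal2 a b" by (rule ideal2I[of _ _ 0 _ x]) simp

lemma ideal2_add:
  assumes "x \<in> ideal2 a b" "y \<in> ideal2 a b" shows "x + y \<in> ideal2 a b"
proof -
  from assms obtain s t u v where "x = a * s + b * t" "y = a * u + b * v"
    by (elim ideal2E)
  then show ?thesis by (intro ideal2I[of _ _ "s + u" _ "t + v"]) (simp add: algebra_simps)
qed

lemma ideal2_mult:
  assumes "x \<in> ideal2 a b" shows "c * x \<in> ideal2 a b"
proof -
  from assms obtain s t where "x = a * s + b * t" by (elim ideal2E)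
  then show ?thesis by (intro ideal2I[of _ _ "c * s" _ "c * t"]) (simp add: algebra_simps)
qed

lemma ideal2_mult': "x \<in> ideal2 a b \<Longrightarrow> x * c \<in> ideal2 a b"
  by (metis ideal2_mult mult.commute)

lemma ideal2_diff:
  assumes "x \<in> ideal2 a b" "y \<in> ideal2 a b" shows "x - y \<in> ideal2 a b"
  using ideal2_add[OF assms(1) ideal2_mult[OF assms(2), of "-1"]] by simp

lemma ideal2_subset:
  assumes "x \<in> ideal2 a b" "b \<in> ideal2 a c" shows "x \<in> ideal2 a c"
proof -
  from assms obtain s t where "x = a * s + b * t" by (elim ideal2E)
  then show ?thesis using assms(2) by (auto intro!: ideal2_add intro: ideal2_mult')
qed

lemma prime_ideal2_power:
  assumes "prime_ideal2 a b" "x ^ n \<in> ideal2 a b"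
  shows "x \<in> ideal2 a b"
  using assms(2)
proof (induction n)
  case 0
  then show ?case using assms(1) by (auto simp: prime_ideal2_def)
next
  case (Suc n)
  then show ?case using assms(1) by (auto simp: prime_ideal2_def)
qed

lemma ideal2_sqI:
  "z = a\<^sup>2 * s + a * b * t + b\<^sup>2 * u \<Longrightarrow> z \<in> ideal2_sq a b"
  unfolding ideal2_sq_def by blast

lemma ideal2_sqE:
  assumes "z \<in> ideal2_sq a b" obtains s t u where "z = a\<^sup>2 * s + a * b * t + b\<^sup>2 * u"
  using assms unfolding ideal2_sq_def by blast

lemma ideal2_sq_add:
  assumes "x \<in> ideal2_sq a b" "y \<in> ideal2_sq a b" shows "x + y \<in> ideal2_sq a b"
proof -
  from assms obtain s t u s' t' u' where
    "x = a\<^sup>2 * s + a * b * t + b\<^sup>2 * u" "y = a\<^sup>2 * s' + a * b * t' + b\<^sup>2 * u'"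
    by (elim ideal2_sqE)
  then show ?thesis
    by (intro ideal2_sqI[of _ _ "s + s'" _ "t + t'" "u + u'"]) (simp add: algebra_simps)
qed

lemma ideal2_sq_mult:
  assumes "x \<in> ideal2_sq a b" shows "c * x \<in> ideal2_sq a b"
proof -
  from assms obtain s t u where "x = a\<^sup>2 * s + a * b * t + b\<^sup>2 * u" by (elim ideal2_sqE)
  then show ?thesis
    by (intro ideal2_sqI[of _ _ "c * s" _ "c * t" "c * u"]) (simp add: algebra_simps)
qed

lemma ideal2_sq_diff:
  assumes "x \<in> ideal2_sq a b" "y \<in> ideal2_sq a b" shows "x - y \<in> ideal2_sq a b"
  using ideal2_sq_add[OF assms(1) ideal2_sq_mult[OF assms(2), of "-1"]] by simp

lemma ideal2_sq_prod:
  assumes "x \<in> ideal2 a b" "y \<in> ideal2 a b" shows "x * y \<in> ideal2_sq a b"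
proof -
  from assms obtain s t u v where "x = a * s + b * t" "y = a * u + b * v"
    by (elim ideal2E)
  then show ?thesis
    by (intro ideal2_sqI[of _ _ "s * u" _ "s * v + t * u" "t * v"])
      (simp add: algebra_simps power2_eq_square)
qed

lemma ideal2_sq_subset: "x \<in> ideal2_sq a b \<Longrightarrow> x \<in> ideal2 a b"
  by (elim ideal2_sqE) (auto simp: power2_eq_square mult.assoc intro!: ideal2_add)

section \<open>Integer polynomials modulo a prime\<close>

lemma dvd_power_diff:
  fixes x y :: "'a::comm_ring_1"
  assumes "f dvd x - y" shows "f dvd x ^ n - y ^ n"
  using assms by (metis dvd_mult2 power_diff_sumr2)

lemma monic_division:
  fixes f g :: "'a::idom poly"
  assumes "lead_coeff f = 1"
  obtains q r where "g = f * q + r" "r = 0 \<or> degree r < degree f"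
proof -
  have "f \<noteq> 0" using assms by auto
  obtain q r where "pseudo_divmod g f = (q, r)" by (cases "pseudo_divmod g f")
  from pseudo_divmod[OF \<open>f \<noteq> 0\<close> this] assms that show thesis by simp
qed

lemma degree_monic_mult:
  fixes f g :: "'a::idom poly"
  assumes "lead_coeff f = 1" "g \<noteq> 0"
  shows "degree (f * g) = degree f + degree g"
  using assms by (intro degree_mult_eq) auto

lemma of_int_dvd_poly_iff:
  fixes r :: "int poly"
  shows "of_int c dvd r \<longleftrightarrow> (\<forall>i. c dvd coeff r i)"
  by (simp add: of_int_poly const_poly_dvd_iff)

lemma degree_of_int_mult:
  fixes r :: "int poly" assumes "c \<noteq> 0" shows "degree (of_int c * r) = degree r"
  using assms by (simp add: of_int_poly)

text \<open>Z[x]/(f) is torsion-free for monic f: the remainder \<open>r\<close> of x satisfies f |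
  c r, which its degree allows only for r = 0.\<close>

lemma monic_dvd_cancel:
  fixes f x :: "int poly"
  assumes f: "lead_coeff f = 1" and c: "c \<noteq> 0" and d: "f dvd of_int c * x"
  shows "f dvd x"
proof -
  obtain q r where x: "x = f * q + r" and r: "r = 0 \<or> degree r < degree f"
    using monic_division[OF f] .
  have "f dvd of_int c * r"
  proof -
    have "of_int c * r = of_int c * x - f * (of_int c * q)" by (simp add: x algebra_simps)
    then show ?thesis using d by simp
  qed
  then obtain z where z: "of_int c * r = f * z" by blast
  have "r = 0"
  proof (rule ccontr)
    assume "r \<noteq> 0"
    moreover from this have "z \<noteq> 0" using c z by auto
    ultimately show False
      using degree_monic_mult[OF f \<open>z \<noteq> 0\<close>] degree_of_int_mult[OF c, of r] r z by simp
  qed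
  then show ?thesis using x by simp
qed

lemma monic_dvd_cancel_power:
  fixes f x :: "int poly"
  assumes "lead_coeff f = 1" and "c \<noteq> 0" and "f dvd of_int c ^ n * x"
  shows "f dvd x"
  using monic_dvd_cancel[of f "c ^ n" x] assms by simp

text \<open>Modulo p, the degree of r is the largest index \<open>d\<close> whose coefficient p does
  not divide. Scaling by an inverse of that coefficient and cutting off above \<open>d\<close> gives
  a monic polynomial.\<close>

lemma exists_monic_mod:
  fixes r :: "int poly" and p :: int
  assumes p: "prime p" and r: "\<not> of_int p dvd r"
  obtains s c a where "lead_coeff s = 1" "degree s \<le> degree r" "s = of_int c * r + of_int p * a"
proof -
  define A where "A = {i. \<not> p dvd coeff r i}"
  have fin: "finite A" unfolding A_def
    by (rule finite_subset[of _ "{..degree r}"]) (auto intro: ccontr simp: not_le coeff_eq_0)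
  have ne: "A \<noteq> {}" using r by (auto simp: A_def of_int_dvd_poly_iff)
  define d where "d = Max A"
  have dA: "d \<in> A" unfolding d_def using fin ne by (rule Max_in)
  have gt: "p dvd coeff r i" if "i > d" for i
    using that Max_ge[OF fin, of i] by (force simp: A_def d_def)
  have dle: "d \<le> degree r" using dA by (auto simp: A_def intro: ccontr simp: not_le coeff_eq_0)
  have "coprime p (coeff r d)" using p dA by (simp add: A_def prime_imp_coprime)
  then obtain c where "[coeff r d * c = 1] (mod p)"
    by (metis cong_solve_coprime_int algebraic_semidom_class.coprime_commute)
  then have c: "p dvd c * coeff r d - 1" by (simp add: cong_iff_dvd_diff mult.commute)
  define s where "s = poly_cutoff d (smult c r) + monom 1 d"
  have cs: "coeff s i = (if i < d then c * coeff r i else if i = d then 1 else 0)" for i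
    by (auto simp: s_def coeff_poly_cutoff)
  have degs: "degree s = d"
  proof (rule antisym)
    show "degree s \<le> d" by (rule degree_le) (auto simp: cs)
    show "d \<le> degree s" by (rule le_degree) (auto simp: cs)
  qed
  have "of_int p dvd s - of_int c * r"
    unfolding of_int_dvd_poly_iff using c gt
    by (auto simp: cs of_int_poly dvd_diff_commute not_less intro!: dvd_mult)
  then obtain a where "s - of_int c * r = of_int p * a" by blast
  then have "s = of_int c * r + of_int p * a" by (simp add: algebra_simps)
  with that[of s c a] degs dle cs show thesis by simp
qed

lemma of_int_mem_ideal2:
  fixes \<pi> :: "int poly"
  assumes p: "prime p" and "1 \<notin> ideal2 (of_int p) \<pi>" and c: "of_int c \<in> ideal2 (of_int p) \<pi>"
  shows "p dvd c"
proof (rule ccontr)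
  assume "\<not> p dvd c"
  then have "coprime p c" using p by (simp add: prime_imp_coprime)
  then obtain u where "[c * u = 1] (mod p)"
    by (metis cong_solve_coprime_int algebraic_semidom_class.coprime_commute)
  then obtain v where "c * u - 1 = p * v" by (auto simp: cong_iff_dvd_diff)
  then have "1 = c * u - p * v" by simp
  then have "(of_int 1 :: int poly) = of_int c * of_int u - of_int p * of_int v"
    by (metis of_int_diff of_int_mult)
  then have "(1 :: int poly) = of_int c * of_int u - of_int p * of_int v" by simp
  moreover have "of_int c * of_int u - of_int p * of_int v \<in> ideal2 (of_int p) \<pi>"
    using c by (intro ideal2_diff ideal2_mult' ideal2_gen1)
  ultimately have "1 \<in> ideal2 (of_int p) \<pi>" by metis
  with assms(2) show False by contradiction
qed

text \<open>From f g = c z, torsion-freeness of Z[x]/(f) gives f | z, and f cancels: a monic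
  polynomial is not a zero divisor modulo c.\<close>

lemma of_int_dvd_monic_multD:
  fixes f g :: "int poly"
  assumes f: "lead_coeff f = 1" and c: "c \<noteq> 0" and d: "of_int c dvd f * g"
  shows "of_int c dvd g"
proof -
  from d obtain z where z: "f * g = of_int c * z" by blast
  have "f dvd z" using monic_dvd_cancel[OF f c] z by (metis dvd_triv_left)
  then obtain y where "z = f * y" by blast
  with z have "f * g = f * (of_int c * y)" by (simp add: algebra_simps)
  moreover have "f \<noteq> 0" using f by auto
  ultimately show ?thesis by simp
qed

text \<open>Write c = p e. Then \<pi>^2 u is a multiple of p, so u is one because \<pi> is monic.
  Cancelling p leaves e in (p, \<pi>), hence p | e.\<close>

lemma of_int_mem_ideal2_sq:
  fixes \<pi> :: "int poly"
  assumes p: "prime p" and \<pi>: "lead_coeff \<pi> = 1" and one: "1 \<notin> ideal2 (of_int p) \<pi>"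
    and c: "of_int c \<in> ideal2_sq (of_int p) \<pi>"
  shows "p\<^sup>2 dvd c"
proof (rule ccontr)
  assume n: "\<not> p\<^sup>2 dvd c"
  have "p dvd c" using of_int_mem_ideal2[OF p one] c ideal2_sq_subset by blast
  then obtain e where e: "c = p * e" by blast
  have p0: "p \<noteq> 0" using p by auto
  have ne: "\<not> p dvd e" using n e by (auto simp: power2_eq_square)
  from c obtain s t u where
    "(of_int c :: int poly) = (of_int p)\<^sup>2 * s + of_int p * \<pi> * t + \<pi>\<^sup>2 * u"
    by (elim ideal2_sqE)
  then have eq: "\<pi>\<^sup>2 * u = of_int p * (of_int e - of_int p * s - \<pi> * t)"
    by (simp add: e algebra_simps power2_eq_square)
  have "of_int p dvd u"
  proof (rule of_int_dvd_monic_multD)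
    show "lead_coeff (\<pi>\<^sup>2) = 1" using \<pi> by (simp add: lead_coeff_power)
    show "of_int p dvd \<pi>\<^sup>2 * u" unfolding eq by simp
  qed (use p0 in auto)
  then obtain v where "u = of_int p * v" by blast
  with eq have "of_int p * (\<pi>\<^sup>2 * v) = of_int p * (of_int e - of_int p * s - \<pi> * t)"
    by (simp add: algebra_simps)
  moreover have "(of_int p :: int poly) \<noteq> 0" using p0 by simp
  ultimately have "\<pi>\<^sup>2 * v = of_int e - of_int p * s - \<pi> * t" using mult_left_cancel by blast
  then have "of_int e = of_int p * s + \<pi> * (t + \<pi> * v)"
    by (simp add: algebra_simps power2_eq_square)
  then have "p dvd e" using of_int_mem_ideal2[OF p one] by (blast intro: ideal2I)
  with ne show False by contradiction
qed

lemma monic_degree_0_imp_1: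
  fixes k :: "'a::idom poly" assumes "lead_coeff k = 1" "degree k = 0" shows "k = 1"
  using assms by (metis degree_0_id one_pCons)

section \<open>Dedekind's criterion\<close>

text \<open>A form of Dedekind's criterion: $\mathbb{Z}[x]/(f)$ is maximal at $p$ unless $f$ lies in the
  square of a prime ideal $(p, \pi)$. The hypothesis on \<open>h\<close> says that all powers of
  $h(\theta)/p$ have the common denominator $p^D$.\<close>

theorem dedekind_criterion:
  fixes f h :: "int poly" and p :: int
  assumes p: "prime p" and f: "lead_coeff f = 1"
    and reg: "\<And>\<pi>. lead_coeff \<pi> = 1 \<Longrightarrow> prime_ideal2 (of_int p) \<pi> \<Longrightarrow> f \<in> ideal2 (of_int p) \<pi>
                \<Longrightarrow> f \<notin> ideal2_sq (of_int p) \<pi>"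
    and h: "\<And>j. of_int p ^ D * h ^ j \<in> ideal2 (of_int p ^ j) f"
  shows "h \<in> ideal2 (of_int p) f"
proof (rule ccontr)
  assume hn: "h \<notin> ideal2 (of_int p) f"
  define q :: "int poly" where "q = of_int p"
  have p0: "p \<noteq> 0" using p by auto
  then have q0: "q \<noteq> 0" by (simp add: q_def)
  have cancel: "f dvd x" if "f dvd q ^ n * x" for x n
    using monic_dvd_cancel_power[OF f p0] that unfolding q_def by blast
  \<comment> \<open>\<open>x\<close> in \<open>J\<close> expresses that x/p is integral over
    Z[x]/(f): its powers have a common denominator. Only closure under multiples is used.\<close>
  define J where "J = {x. \<exists>D. \<forall>j. q ^ D * x ^ j \<in> ideal2 (q ^ j) f}"
  define I where "I = ideal2 q f"
  have I_mult: "c * x \<in> I" if "x \<in> I" for x c using that unfolding I_def by (rule ideal2_mult)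
  have I_diff: "x - y \<in> I" if "x \<in> I" "y \<in> I" for x y
    using that unfolding I_def by (rule ideal2_diff)
  have I_q: "q * x \<in> I" and I_f: "f * x \<in> I" for x by (simp_all add: I_def)
  have J_mult: "c * x \<in> J" if xJ: "x \<in> J" for c x
  proof -
    from xJ obtain D where D: "\<And>j. q ^ D * x ^ j \<in> ideal2 (q ^ j) f" unfolding J_def by blast
    have "q ^ D * (c * x) ^ j \<in> ideal2 (q ^ j) f" for j
      using ideal2_mult[OF D[of j], of "c ^ j"] by (simp add: power_mult_distrib mult_ac)
    then show ?thesis unfolding J_def by blast
  qed
  have J_nil: "\<exists>N. x ^ N \<in> I" if xJ: "x \<in> J" for x
  proof -
    \<comment> \<open>The exponent D + 1 leaves exactly one factor q once q^D has been
      cancelled.\<close>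
    from xJ obtain D where "q ^ D * x ^ Suc D \<in> ideal2 (q ^ Suc D) f" unfolding J_def by blast
    then obtain a b where "q ^ D * x ^ Suc D = q ^ Suc D * a + f * b" by (elim ideal2E)
    then have "q ^ D * (x ^ Suc D - q * a) = f * b" by (simp add: algebra_simps)
    then have "f dvd q ^ D * (x ^ Suc D - q * a)" by simp
    then have "f dvd x ^ Suc D - q * a" by (rule cancel)
    then obtain z where "x ^ Suc D - q * a = f * z" by blast
    then have "x ^ Suc D = q * a + f * z" by (simp add: algebra_simps)
    then show ?thesis unfolding I_def by (blast intro: ideal2I)
  qed
  have hJ: "h \<in> J" using h unfolding J_def q_def by blast
  have hI: "h \<notin> I" using hn unfolding I_def q_def .
  \<comment> \<open>By minimality of the degree of \<open>k\<close>, $(p, k)$ is the annihilator modulo $(p, f)$ of \<open>g\<close> and of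
    every multiple of \<open>g\<close> outside $(p, f)$, hence a prime ideal.\<close>
  define S where "S k \<longleftrightarrow> lead_coeff k = 1 \<and> (\<exists>x\<in>J. x \<notin> I \<and> k * x \<in> I)" for k
  have "S f" unfolding S_def using f hJ hI I_f by blast
  then obtain k where Sk: "S k" and k_min: "\<And>k'. S k' \<Longrightarrow> degree k \<le> degree k'"
    using ex_has_least_nat[of S f degree] by blast
  have k: "lead_coeff k = 1" using Sk by (simp add: S_def)
  then have k0: "k \<noteq> 0" by auto
  obtain g where gJ: "g \<in> J" and gI: "g \<notin> I" and kg: "k * g \<in> I" using Sk by (auto simp: S_def)
  define P where "P = ideal2 q k"
  \<comment> \<open>If q did not divide \<open>r\<close>, then \<open>r\<close> could be made monic
    modulo p without raising its degree, contradicting the minimality of \<open>k\<close>.\<close>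
  have low: "q dvd r" if "x \<in> J" "x \<notin> I" "k * x \<in> I" "r * x \<in> I" "r = 0 \<or> degree r < degree k" for x r
  proof (rule ccontr)
    assume nd: "\<not> q dvd r"
    then have "r \<noteq> 0" by auto
    obtain s c a where s: "lead_coeff s = 1" "degree s \<le> degree r" "s = of_int c * r + of_int p * a"
      using exists_monic_mod[OF p nd[unfolded q_def]] by metis
    have "s * x = of_int c * (r * x) - q * (- (a * x))" by (simp add: s(3) q_def algebra_simps)
    then have "s * x \<in> I" using that(4) by (metis I_diff I_mult I_q)
    then have "S s" unfolding S_def using s(1) that(1,2) by blast
    from k_min[OF this] s(2) that(5) \<open>r \<noteq> 0\<close> show False by simp
  qed
  have annih: "b \<in> P" if "x \<in> J" "x \<notin> I" "k * x \<in> I" "b * x \<in> I" for x b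
  proof -
    obtain z r where b: "b = k * z + r" and r: "r = 0 \<or> degree r < degree k"
      using monic_division[OF k] .
    have "r * x = b * x - z * (k * x)" by (simp add: b algebra_simps)
    then have "r * x \<in> I" using that by (simp add: I_diff I_mult)
    from low[OF that(1-3) this r] obtain y where "r = q * y" by blast
    then show ?thesis unfolding P_def by (intro ideal2I[of _ _ y _ z]) (simp add: b)
  qed
  have annih': "b * x \<in> I" if "b \<in> P" "k * x \<in> I" for b x
  proof -
    from that(1) obtain s t where "b = q * s + k * t" unfolding P_def by (elim ideal2E)
    then have "b * x = q * (s * x) - (- t) * (k * x)" by (simp add: algebra_simps)
    then show ?thesis using that(2) I_mult I_diff I_q by metis
  qed
  have prime: "prime_ideal2 q k"
    unfolding prime_ideal2_def P_def[symmetric]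
  proof (intro conjI allI impI)
    show "1 \<notin> P" using annih'[of 1 g] kg gI by auto
    fix x y assume xy: "x * y \<in> P"
    have "x * (y * g) \<in> I" using annih'[OF xy kg] by (simp add: mult_ac)
    moreover have "k * (y * g) \<in> I" using I_mult[OF kg, of y] by (simp add: mult_ac)
    ultimately show "x \<in> P \<or> y \<in> P"
      using annih[OF gJ gI kg, of y] annih[OF J_mult[OF gJ], of y x] by blast
  qed
  then have P1: "1 \<notin> P" and P_prime: "\<And>x y. x * y \<in> P \<Longrightarrow> x \<in> P \<or> y \<in> P"
    by (auto simp: prime_ideal2_def P_def)
  have P_power: "x \<in> P" if "x ^ n \<in> P" for x n
    using prime_ideal2_power[OF prime] that unfolding P_def by blast
  have P_mult: "c * x \<in> P" if "x \<in> P" for x c using that unfolding P_def by (rule ideal2_mult)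
  have P_diff: "x - y \<in> P" if "x \<in> P" "y \<in> P" for x y
    using that unfolding P_def by (rule ideal2_diff)
  have P_q: "q * x \<in> P" and P_k: "k * x \<in> P" for x by (simp_all add: P_def)
  have fP: "f \<in> P" using annih[OF gJ gI kg I_f] .
  have IP: "x \<in> P" if "x \<in> I" for x
    using that fP unfolding P_def I_def by (rule ideal2_subset)
  have JP: "x \<in> P" if "x \<in> J" for x using J_nil[OF that] IP P_power by blast
  have k_deg: "degree k > 0"
    using k P1 P_k[of 1] monic_degree_0_imp_1[OF k] by (intro Nat.gr0I) auto
  have fsq: "f \<notin> ideal2_sq q k"
    using reg[OF k] prime fP unfolding q_def P_def by blast
  obtain r u where fr: "f = q * r + k * u" using fP unfolding P_def by (elim ideal2E)
  obtain g2 g1 where g: "g = q * g2 + k * g1" using JP[OF gJ] unfolding P_def by (elim ideal2E)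
  \<comment> \<open>Modulo f, the product k u equals -q r, so u g becomes a multiple of q.\<close>
  have uP: "u \<in> P"
  proof (rule annih[OF gJ gI kg])
    have "u * g = q * (u * g2 - r * g1) + f * g1" by (simp add: fr g algebra_simps)
    then show "u * g \<in> I" unfolding I_def by (rule ideal2I)
  qed
  \<comment> \<open>The regularity of f enters here. With r outside P, the relation f = q r + k u
    says that P is generated by \<open>k\<close> alone locally in Z[x]/(f).\<close>
  have rP: "r \<notin> P"
  proof
    assume "r \<in> P"
    have "q * r + k * u \<in> ideal2_sq q k"
      using \<open>r \<in> P\<close> uP P_q[of 1] P_k[of 1] unfolding P_def
      by (intro ideal2_sq_add ideal2_sq_prod) auto
    with fsq fr show False by simp
  qed
  \<comment> \<open>Dividing k g by q modulo f gives \<open>a\<close>. The aim of the next steps is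
    that \<open>a\<close> lies outside P, so that g/p is a unit multiple of 1/k locally at
    P.\<close>
  obtain a e where kg': "k * g = q * a + f * e" using kg unfolding I_def by (elim ideal2E)
  have "k * (g - u * e) = q * (a + r * e)" using kg' by (simp add: fr algebra_simps)
  then have "k dvd of_int p * (a + r * e)" unfolding q_def by (metis dvd_triv_left)
  from monic_dvd_cancel[OF k p0 this] obtain d where d: "a + r * e = k * d" by blast
  with \<open>k * (g - u * e) = _\<close> have "k * (g - u * e) = k * (q * d)" by (simp add: mult_ac)
  then have "g - u * e = q * d" using k0 mult_left_cancel by blast
  then have g': "g = u * e + q * d" by (simp add: algebra_simps)
  have eP: "e \<notin> P"
  proof
    assume "e \<in> P"
    then obtain e2 e1 where "e = q * e2 + k * e1" unfolding P_def by (elim ideal2E)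
    then have "g = q * (u * e2 + d - r * e1) + f * e1" by (simp add: g' fr algebra_simps)
    then have "g \<in> I" unfolding I_def by (rule ideal2I)
    with gI show False by contradiction
  qed
  have aP: "a \<notin> P"
  proof
    assume "a \<in> P"
    have "r * e = k * d - a" using d by (simp add: algebra_simps)
    then have "r * e \<in> P" using \<open>a \<in> P\<close> P_diff P_k by metis
    with P_prime rP eP show False by blast
  qed
  \<comment> \<open>Locally at $(p, k)$, the element \<open>k\<close> is nilpotent modulo $(p, y)$.\<close>
  have kpow: "\<exists>n w. w \<notin> P \<and> k ^ n * w \<in> ideal2 q y" if "lead_coeff y = 1" for y
    using that
  proof (induction "degree y" arbitrary: y rule: less_induct)
    case less
    show ?case
    proof (cases "y \<in> P")
      case False
      then show ?thesis by (intro exI[of _ 0] exI[of _ y]) (auto intro: ideal2I[of _ _ 0 _ 1])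
    next
      case True
      obtain z t where y: "y = k * z + t" and t: "t = 0 \<or> degree t < degree k"
        using monic_division[OF k] .
      have "t = y - k * z" by (simp add: y)
      then have "t \<in> P" using True P_k P_diff by metis
      \<comment> \<open>The remainder of y modulo \<open>k\<close> annihilates \<open>g\<close> and
        has degree below that of \<open>k\<close>, so it is a multiple of q. Hence y agrees with k z
        modulo q, and the induction continues with z.\<close>
      then have "t * g \<in> I" using kg by (rule annih')
      from low[OF gJ gI kg this t] obtain t' where t': "t = q * t'" by blast
      have "z \<noteq> 0"
      proof
        assume "z = 0"
        then have "y = of_int p * t'" using y t' q_def by simp
        then have "of_int p dvd y" by simp
        then have "p dvd 1" using less.prems by (metis of_int_dvd_poly_iff)
        with p show False using not_prime_unit by blast
      qed
      then have dkz: "degree (k * z) = degree k + degree z" by (rule degree_monic_mult[OF k])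
      then have dt: "degree t < degree (k * z)" using t k_deg by auto
      then have dy: "degree y = degree k + degree z" unfolding y by (simp add: degree_add_eq_left dkz)
      have "lead_coeff y = lead_coeff (k * z)" unfolding y
        using dt by (metis add.commute lead_coeff_add_le)
      then have "lead_coeff z = 1" using less.prems k by (simp add: lead_coeff_mult)
      from less.hyps[OF _ this] dy k_deg obtain n w where w: "w \<notin> P" "k ^ n * w \<in> ideal2 q z"
        by auto
      from w(2) obtain b c where "k ^ n * w = q * b + z * c" by (elim ideal2E)
      then have "k ^ Suc n * w = q * (k * b - t' * c) + y * c" by (simp add: y t' algebra_simps)
      then show ?thesis using w(1) by (blast intro: ideal2I)
    qed
  qed
  obtain n w where wP: "w \<notin> P" and kw: "k ^ n * w \<in> I" using kpow[OF f] unfolding I_def by blast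
  have "n \<noteq> 0" using wP kw IP by (intro notI) auto
  then obtain n' where n': "n = Suc n'" by (cases n) auto
  from kw obtain y z where kw': "k ^ n * w = q * y + f * z" unfolding I_def by (elim ideal2E)
  \<comment> \<open>Since $a = k\,(g/p)$ in $\mathbb{Z}[x]/(f)$, the element \<open>t\<close> is \<open>p\<close> times something integral,
    hence nilpotent modulo $(p, f)$; but neither \<open>a\<close> nor \<open>w\<close> lies in the prime \<open>P\<close>.\<close>
  define t where "t = a ^ n * w"
  have "f dvd (q * a) ^ n - (k * g) ^ n" by (rule dvd_power_diff) (simp add: kg')
  then have "f dvd ((q * a) ^ n - (k * g) ^ n) * w + f * z * g ^ n" by (intro dvd_add) auto
  also have "((q * a) ^ n - (k * g) ^ n) * w + f * z * g ^ n
      = q ^ n * t - (k ^ n * w - f * z) * g ^ n"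
    by (simp add: t_def power_mult_distrib algebra_simps)
  also have "k ^ n * w - f * z = q * y" using kw' by simp
  \<comment> \<open>The form \<open>q ^ 1\<close> matches the rule \<open>cancel\<close>. The result
    says t/q = y (g/q)^n modulo f.\<close>
  also have "q ^ n * t - q * y * g ^ n = q ^ 1 * (q ^ n' * t - y * g ^ n)"
    by (simp add: n' algebra_simps)
  finally have fd: "f dvd q ^ n' * t - y * g ^ n" by (rule cancel)
  have "t \<in> J"
  proof -
    from gJ obtain D where D: "\<And>j. q ^ D * g ^ j \<in> ideal2 (q ^ j) f" unfolding J_def by blast
    have "q ^ D * t ^ j \<in> ideal2 (q ^ j) f" for j
    proof -
      \<comment> \<open>The j-th power of t/q contains the (n j)-th power of g/q, so the bound
        \<open>D\<close> for \<open>g\<close> serves for \<open>t\<close> too.\<close>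
      obtain A B where AB: "q ^ D * g ^ (n * j) = q ^ (n * j) * A + f * B"
        using D[of "n * j"] by (elim ideal2E)
      have "f dvd (q ^ n' * t) ^ j - (y * g ^ n) ^ j" using fd by (rule dvd_power_diff)
      then have "f dvd q ^ D * ((q ^ n' * t) ^ j - (y * g ^ n) ^ j) + f * B * y ^ j"
        by (intro dvd_add) auto
      also have "q ^ D * ((q ^ n' * t) ^ j - (y * g ^ n) ^ j) + f * B * y ^ j
         = q ^ (n' * j) * (q ^ D * t ^ j) - (q ^ D * g ^ (n * j) - f * B) * y ^ j"
        by (simp add: power_mult_distrib algebra_simps flip: power_mult)
      also have "q ^ D * g ^ (n * j) - f * B = q ^ (n' * j) * q ^ j * A"
        using AB by (simp add: n' power_add mult_ac)
      also have "q ^ (n' * j) * (q ^ D * t ^ j) - q ^ (n' * j) * q ^ j * A * y ^ j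
         = q ^ (n' * j) * (q ^ D * t ^ j - q ^ j * (A * y ^ j))"
        by (simp add: algebra_simps)
      finally have "f dvd q ^ D * t ^ j - q ^ j * (A * y ^ j)" by (rule cancel)
      then obtain C where "q ^ D * t ^ j - q ^ j * (A * y ^ j) = f * C" by blast
      then have "q ^ D * t ^ j = q ^ j * (A * y ^ j) + f * C" by (simp add: algebra_simps)
      then show ?thesis by (rule ideal2I)
    qed
    then show ?thesis unfolding J_def by blast
  qed
  then have "a ^ n * w \<in> P" using JP by (simp add: t_def)
  then show False using P_prime P_power aP wP by blast
qed

section \<open>Rings of integers\<close>

abbreviation eval_int :: "complex \<Rightarrow> int poly \<Rightarrow> complex" where
  "eval_int \<theta> g \<equiv> poly (map_poly of_int g) \<theta>"

lemma eval_int_simps: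
  "eval_int \<theta> (g + h) = eval_int \<theta> g + eval_int \<theta> h"
  "eval_int \<theta> (g - h) = eval_int \<theta> g - eval_int \<theta> h"
  "eval_int \<theta> (- g) = - eval_int \<theta> g"
  "eval_int \<theta> (g * h) = eval_int \<theta> g * eval_int \<theta> h"
  "eval_int \<theta> (g ^ k) = eval_int \<theta> g ^ k"
  "eval_int \<theta> (of_int c) = of_int c"
  "eval_int \<theta> 1 = 1" "eval_int \<theta> 0 = 0"
  by (simp_all add: hom_distribs)

lemma eval_int_X: "eval_int \<theta> [:0, 1:] = \<theta>"
  by (simp add: map_poly_pCons)

lemma eval_int_altdef: "eval_int \<theta> g = (\<Sum>i\<le>degree g. of_int (coeff g i) * \<theta> ^ i)"
  by (simp add: poly_altdef)

text \<open>Multiplication by z on the span of S is described by an integer matrix. The vector of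
  the elements of S is an eigenvector for z, nonzero because S contains 1, so z is a root of the
  monic characteristic polynomial.\<close>

lemma algebraic_int_if_span_stable:
  fixes S :: "complex set"
  assumes S: "finite S" "1 \<in> S" and stable: "\<And>x. x \<in> S \<Longrightarrow> z * x \<in> int_module.span S"
  shows "algebraic_int z"
proof -
  define N where "N = card S"
  obtain s where s: "bij_betw s {..<N} S"
    using ex_bij_betw_nat_finite[OF S(1)] by (auto simp: N_def atLeast0LessThan)
  have "\<forall>x\<in>S. \<exists>u. z * x = (\<Sum>v\<in>S. of_int (u v) * v)"
    using stable unfolding int_module.span_finite[OF S(1)] by blast
  then obtain u where u: "\<And>x. x \<in> S \<Longrightarrow> z * x = (\<Sum>v\<in>S. of_int (u x v) * v)" by metis
  define A :: "int mat" where "A = mat N N (\<lambda>(i, j). u (s i) (s j))"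
  have A: "A \<in> carrier_mat N N" by (simp add: A_def)
  define A' :: "complex mat" where "A' = map_mat of_int A"
  have A': "A' \<in> carrier_mat N N" using A by (simp add: A'_def)
  define v where "v = vec N s"
  have "A' *\<^sub>v v = z \<cdot>\<^sub>v v"
  proof (rule eq_vecI)
    fix i assume "i < dim_vec (z \<cdot>\<^sub>v v)"
    then have i: "i < N" by (simp add: v_def)
    then have si: "s i \<in> S" using s by (auto simp: bij_betw_def)
    have "(A' *\<^sub>v v) $ i = (\<Sum>j\<in>{0..<N}. of_int (u (s i) (s j)) * s j)"
      using i A' by (simp add: A'_def A_def v_def scalar_prod_def)
    also have "\<dots> = (\<Sum>x\<in>S. of_int (u (s i) x) * x)"
      using sum.reindex_bij_betw[OF s, of "\<lambda>x. of_int (u (s i) x) * x"] by (simp add: atLeast0LessThan)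
    also have "\<dots> = z * s i" using u[OF si] by simp
    finally show "(A' *\<^sub>v v) $ i = (z \<cdot>\<^sub>v v) $ i" using i by (simp add: v_def)
  qed (simp add: v_def A'_def A_def)
  moreover have "v \<noteq> 0\<^sub>v N"
  proof
    assume v0: "v = 0\<^sub>v N"
    obtain i where "i < N" "s i = 1" using s S(2) by (auto simp: bij_betw_def)
    then show False using arg_cong[OF v0, of "\<lambda>w. vec_index w i"] by (simp add: v_def)
  qed
  ultimately have "eigenvalue A' z"
    unfolding eigenvalue_def eigenvector_def using A' by (intro exI[of _ v]) (auto simp: v_def)
  then have "poly (char_poly A') z = 0" using eigenvalue_root_char_poly[OF A'] by simp
  moreover have "char_poly A' = map_poly of_int (char_poly A)"
    unfolding A'_def by (rule of_int_hom.char_poly_hom[OF A])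
  ultimately have "poly (map_poly of_int (char_poly A)) z = 0" by simp
  moreover have "lead_coeff (char_poly A) = 1"
    using degree_monic_char_poly[OF A] by simp
  ultimately show ?thesis unfolding algebraic_int_altdef_ipoly by blast
qed

lemma span_image_mult_right:
  "x \<in> int_module.span S \<Longrightarrow> x * c \<in> int_module.span ((\<lambda>y. y * c) ` S)"
proof (induction rule: int_module.span_induct_alt)
  case base
  then show ?case by (simp add: int_module.span_zero)
next
  case (step k y z)
  have "(of_int k * y + z) * c = of_int k * (y * c) + z * c" by (simp add: algebra_simps)
  moreover have "y * c \<in> int_module.span ((\<lambda>y. y * c) ` S)"
    using step(1) by (intro int_module.span_base image_eqI[of _ _ y]) auto
  ultimately show ?case using step by (simp add: int_module.span_add int_module.span_scale)
qed

lemma span_powers_eq: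
  fixes f :: "int poly"
  assumes f: "lead_coeff f = 1" and root: "eval_int \<theta> f = 0"
  shows "int_module.span ((\<lambda>i. \<theta> ^ i) ` {..<degree f}) = range (eval_int \<theta>)"
proof (intro subset_antisym subsetI)
  fix x assume "x \<in> int_module.span ((\<lambda>i. \<theta> ^ i) ` {..<degree f})"
  then show "x \<in> range (eval_int \<theta>)"
  proof (induction rule: int_module.span_induct_alt)
    case base
    show ?case by (rule range_eqI[of _ _ 0]) simp
  next
    case (step c x y)
    then obtain i g where "x = \<theta> ^ i" "y = eval_int \<theta> g" by auto
    then have "of_int c * x + y = eval_int \<theta> (of_int c * [:0,1:] ^ i + g)"
      by (simp only: eval_int_simps eval_int_X)
    then show ?case by blast
  qed
next
  fix x assume "x \<in> range (eval_int \<theta>)"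
  then obtain g where g: "x = eval_int \<theta> g" by blast
  obtain q r where qr: "g = f * q + r" and r: "r = 0 \<or> degree r < degree f"
    using monic_division[OF f] .
  have "x = eval_int \<theta> r" by (simp only: g qr eval_int_simps root) simp
  also have "\<dots> \<in> int_module.span ((\<lambda>i. \<theta> ^ i) ` {..<degree f})"
  proof (cases "r = 0")
    case False
    then show ?thesis using r unfolding eval_int_altdef
      by (intro int_module.span_sum int_module.span_scale int_module.span_base) auto
  qed (simp add: int_module.span_zero)
  finally show "x \<in> int_module.span ((\<lambda>i. \<theta> ^ i) ` {..<degree f})" .
qed

text \<open>An element that is quadratic over Z[\<theta>] stabilizes Z[\<theta>] + Z[\<theta>] w:
  the equation rewrites w^2 in terms of w and 1.\<close>

lemma algebraic_int_quadratic:
  fixes f :: "int poly"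
  assumes f: "lead_coeff f = 1" "degree f > 0" and root: "eval_int \<theta> f = 0"
    and w: "w\<^sup>2 + eval_int \<theta> B * w + eval_int \<theta> C = 0"
  shows "algebraic_int w"
proof -
  define T where "T = (\<lambda>i. \<theta> ^ i) ` {..<degree f}"
  have span_T: "eval_int \<theta> g \<in> int_module.span T" for g
    using span_powers_eq[OF f(1) root] by (auto simp: T_def)
  define S where "S = T \<union> (\<lambda>y. y * w) ` T"
  have TS: "int_module.span T \<subseteq> int_module.span S" "int_module.span ((\<lambda>y. y * w) ` T) \<subseteq> int_module.span S"
    by (auto simp: S_def intro!: int_module.span_mono)
  show ?thesis
  proof (rule algebraic_int_if_span_stable[of S])
    show "finite S" by (simp add: S_def T_def)
    show "1 \<in> S" using f(2) by (auto simp: S_def T_def intro!: image_eqI[of _ _ 0])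
    fix x assume "x \<in> S"
    then consider "x \<in> T" | y where "y \<in> T" "x = y * w" by (auto simp: S_def)
    then show "w * x \<in> int_module.span S"
    proof cases
      case 1
      then have "w * x \<in> S" by (auto simp: S_def mult.commute)
      then show ?thesis by (rule int_module.span_base)
    next
      case 2
      then obtain i where y: "y = \<theta> ^ i" by (auto simp: T_def)
      have "w\<^sup>2 - (- (eval_int \<theta> B * w) - eval_int \<theta> C) = 0"
        using w by (simp add: algebra_simps)
      then have w2: "w\<^sup>2 = - (eval_int \<theta> B * w) - eval_int \<theta> C"
        by (simp only: right_minus_eq)
      have "w * x = w\<^sup>2 * \<theta> ^ i" by (simp add: 2(2) y power2_eq_square)
      also have "\<dots> = eval_int \<theta> (- B * [:0,1:] ^ i) * w + eval_int \<theta> (- C * [:0,1:] ^ i)"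
        unfolding eval_int_simps eval_int_X w2 by (simp add: algebra_simps)
      also have "\<dots> \<in> int_module.span S"
        using span_image_mult_right[OF span_T] span_T TS by (intro int_module.span_add) blast+
      finally show ?thesis .
    qed
  qed
qed

lemma algebraic_int_eval_int:
  fixes f :: "int poly"
  assumes f: "lead_coeff f = 1" "degree f > 0" and root: "eval_int \<theta> f = 0"
  shows "algebraic_int (eval_int \<theta> g)"
\<comment> \<open>The value w = g(\<theta>) trivially satisfies w^2 - g(\<theta>) w + 0 = 0.\<close>
proof (rule algebraic_int_quadratic[OF assms, of _ "- g" 0])
  show "(eval_int \<theta> g)\<^sup>2 + eval_int \<theta> (- g) * eval_int \<theta> g + eval_int \<theta> 0 = 0"
    unfolding eval_int_simps by (simp add: power2_eq_square)
qed

section \<open>The field Q(\<theta>) as the ring Q[\<theta>]\<close>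

lemma eval_rat_simps:
  fixes \<theta> :: complex
  shows "poly (map_poly of_rat (g + h)) \<theta> = poly (map_poly of_rat g) \<theta> + poly (map_poly of_rat h) \<theta>"
    "poly (map_poly of_rat (g - h)) \<theta> = poly (map_poly of_rat g) \<theta> - poly (map_poly of_rat h) \<theta>"
    "poly (map_poly of_rat (g * h)) \<theta> = poly (map_poly of_rat g) \<theta> * poly (map_poly of_rat h) \<theta>"
proof -
  interpret map_poly_comm_ring_hom "of_rat :: rat \<Rightarrow> complex" ..
  show "poly (map_poly of_rat (g + h)) \<theta> = poly (map_poly of_rat g) \<theta> + poly (map_poly of_rat h) \<theta>"
    "poly (map_poly of_rat (g - h)) \<theta> = poly (map_poly of_rat g) \<theta> - poly (map_poly of_rat h) \<theta>"
    "poly (map_poly of_rat (g * h)) \<theta> = poly (map_poly of_rat g) \<theta> * poly (map_poly of_rat h) \<theta>"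
    by (simp_all add: hom_distribs)
qed

lemma inverse_at_root:
  fixes F G :: "rat poly" and \<theta> :: complex
  assumes F: "irreducible F" and root: "poly (map_poly of_rat F) \<theta> = 0"
    and ne: "\<not> F dvd G"
  obtains B where "poly (map_poly of_rat B) \<theta> * poly (map_poly of_rat G) \<theta> = 1"
proof -
  have "prime_elem F" using F by (simp add: irreducible_imp_prime_elem_gcd)
  then have "coprime F G" using ne by (rule prime_elem_imp_coprime)
  then have "fst (bezout_coefficients F G) * F + snd (bezout_coefficients F G) * G = 1"
    by (metis bezout_coefficients_fst_snd coprime_imp_gcd_eq_1)
  then obtain A B where "A * F + B * G = 1" by blast
  then have "poly (map_poly of_rat (A * F + B * G)) \<theta> = 1" by simp
  then have "poly (map_poly of_rat B) \<theta> * poly (map_poly of_rat G) \<theta> = 1"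
    using root by (simp add: eval_rat_simps hom_distribs)
  then show thesis by (rule that)
qed

lemma map_poly_of_rat_of_int: "map_poly of_rat (map_poly rat_of_int g) = (map_poly of_int g :: complex poly)"
  by (simp add: map_poly_map_poly o_def)

lemma rat_adjoin_imp_poly:
  fixes F :: "rat poly"
  assumes F: "irreducible F" and root: "poly (map_poly of_rat F) \<theta> = 0"
  assumes "z \<in> rat_adjoin \<theta>"
  shows "\<exists>G. z = poly (map_poly of_rat G) \<theta>"
  using assms(3)
proof induction
  case (rat q)
  show ?case by (rule exI[of _ "[:q:]"]) (simp add: eval_rat_simps hom_distribs)
next
  case gen
  show ?case by (rule exI[of _ "[:0,1:]"]) (simp add: map_poly_pCons)
next
  case (add x y)
  then obtain G H where "x = poly (map_poly of_rat G) \<theta>" "y = poly (map_poly of_rat H) \<theta>" by blast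
  then show ?case by (intro exI[of _ "G + H"]) (simp add: eval_rat_simps hom_distribs)
next
  case (diff x y)
  then obtain G H where "x = poly (map_poly of_rat G) \<theta>" "y = poly (map_poly of_rat H) \<theta>" by blast
  then show ?case by (intro exI[of _ "G - H"]) (simp add: eval_rat_simps hom_distribs)
next
  case (mult x y)
  then obtain G H where "x = poly (map_poly of_rat G) \<theta>" "y = poly (map_poly of_rat H) \<theta>" by blast
  then show ?case by (intro exI[of _ "G * H"]) (simp add: eval_rat_simps hom_distribs)
next
  case (inv x)
  then obtain G where x: "x = poly (map_poly of_rat G) \<theta>" by blast
  show ?case
  proof (cases "F dvd G")
    case True
    then have "x = 0" using root by (auto simp: x eval_rat_simps)
    then show ?thesis by (intro exI[of _ 0]) simp
  next
    case False
    obtain B where "poly (map_poly of_rat B) \<theta> * x = 1"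
      using inverse_at_root[OF F root False] x by blast
    then show ?thesis by (intro exI[of _ B]) (metis inverse_unique mult.commute)
  qed
qed

lemma rat_adjoin_sum:
  assumes "\<And>i. i \<in> A \<Longrightarrow> g i \<in> rat_adjoin \<theta>" shows "sum g A \<in> rat_adjoin \<theta>"
  using assms
proof (induction A rule: infinite_finite_induct)
  case (insert x A)
  then show ?case by (simp add: rat_adjoin.add)
qed (use rat_adjoin.rat[of 0 \<theta>] in simp_all)

lemma rat_adjoin_power: "x \<in> rat_adjoin \<theta> \<Longrightarrow> x ^ k \<in> rat_adjoin \<theta>"
proof (induction k)
  case 0
  show ?case using rat_adjoin.rat[of 1 \<theta>] by simp
qed (simp add: rat_adjoin.mult)

lemma of_int_rat_adjoin: "of_int c \<in> rat_adjoin \<theta>"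
  using rat_adjoin.rat[of "of_int c" \<theta>] by simp

lemma eval_int_rat_adjoin: "eval_int \<theta> g \<in> rat_adjoin \<theta>"
  unfolding eval_int_altdef
  by (intro rat_adjoin_sum rat_adjoin.mult rat_adjoin_power rat_adjoin.gen of_int_rat_adjoin)

section \<open>Z[\<theta>] inside the ring of integers, for monic irreducible f\<close>

locale integral_generator =
  fixes f :: "int poly" and \<theta> :: complex
  assumes monic: "lead_coeff f = 1"
    and irred: "irreducible (map_poly rat_of_int f)"
    and root: "eval_int \<theta> f = 0"
begin

lemma root': "poly (map_poly of_rat (map_poly rat_of_int f)) \<theta> = 0"
  using root by (simp add: map_poly_of_rat_of_int)

lemma degree_pos: "degree f > 0"
proof (rule Nat.gr0I)
  assume "degree f = 0"
  then have "f = 1" using monic monic_degree_0_imp_1 by blast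
  with root show False by simp
qed

lemma eval_int_eq_0_imp:
  assumes "eval_int \<theta> g = 0" "degree g < degree f" shows "g = 0"
proof (rule ccontr)
  assume g: "g \<noteq> 0"
  have "\<not> map_poly rat_of_int f dvd map_poly rat_of_int g"
  proof
    assume "map_poly rat_of_int f dvd map_poly rat_of_int g"
    then have "degree (map_poly rat_of_int f) \<le> degree (map_poly rat_of_int g)"
      using g by (intro dvd_imp_degree_le) auto
    with assms(2) show False by simp
  qed
  from inverse_at_root[OF irred root' this] show False
    using assms(1) by (metis map_poly_of_rat_of_int mult_zero_right zero_neq_one)
qed

lemma eval_int_eq_0_iff: "eval_int \<theta> g = 0 \<longleftrightarrow> f dvd g"
proof
  assume g0: "eval_int \<theta> g = 0"
  obtain q r where g: "g = f * q + r" and r: "r = 0 \<or> degree r < degree f"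
    using monic_division[OF monic] .
  have "eval_int \<theta> r = 0" using g0 unfolding g eval_int_simps root by simp
  then have "r = 0" using r eval_int_eq_0_imp by blast
  then show "f dvd g" by (simp add: g)
next
  assume "f dvd g"
  then obtain q where "g = f * q" by blast
  then show "eval_int \<theta> g = 0" by (simp only: eval_int_simps root) simp
qed

lemma eval_int_eq_iff: "eval_int \<theta> g = eval_int \<theta> h \<longleftrightarrow> f dvd g - h"
  using eval_int_eq_0_iff[of "g - h"] unfolding eval_int_simps by simp

lemma rat_adjoin_denominator:
  assumes "z \<in> rat_adjoin \<theta>"
  obtains N g where "N > 0" "of_int N * z = eval_int \<theta> g"
proof -
  obtain G where G: "z = poly (map_poly of_rat G) \<theta>"
    using rat_adjoin_imp_poly[OF irred root' assms] by blast
  obtain d q where dq: "rat_to_int_poly G = (d, q)" by force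
  from rat_to_int_poly(1)[OF dq] rat_to_int_poly(2)[OF dq]
  have "d > 0" and "smult (of_int d) G = map_poly of_int q" by auto
  then have "poly (map_poly of_rat (smult (of_int d) G)) \<theta> = eval_int \<theta> q"
    by (simp add: map_poly_of_rat_of_int)
  then have "of_int d * z = eval_int \<theta> q" by (simp add: G hom_distribs)
  with \<open>d > 0\<close> show thesis by (rule that)
qed

lemma independent_powers: "int_module.independent ((\<lambda>i. \<theta> ^ i) ` {..<degree f})"
proof -
  have *: "c i = 0" if "(\<Sum>i<degree f. of_int (c i) * \<theta> ^ i) = 0" "i < degree f" for c i
  proof -
    define g where "g = (\<Sum>i<degree f. monom (c i) i)"
    have cg: "coeff g j = (if j < degree f then c j else 0)" for j
      by (simp add: g_def coeff_sum)
    have "degree g < degree f"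
      using degree_pos by (intro degree_lessI) (auto simp: cg)
    moreover have "eval_int \<theta> g = 0"
      using that(1) by (simp add: g_def hom_distribs poly_sum poly_monom)
    ultimately have "g = 0" by (rule eval_int_eq_0_imp[rotated])
    then show ?thesis using cg[of i] that(2) by simp
  qed
  have inj: "inj_on (\<lambda>i. \<theta> ^ i) {..<degree f}"
  proof (rule inj_onI)
    fix i j assume ij: "i \<in> {..<degree f}" "j \<in> {..<degree f}" "\<theta> ^ i = \<theta> ^ j"
    show "i = j"
    proof (rule ccontr)
      assume "i \<noteq> j"
      \<comment> \<open>A coincidence of two powers is itself a linear relation, with coefficients 1
        and -1.\<close>
      define c where "c k = (if k = i then 1 else if k = j then -1 else 0 :: int)" for k
      have "(\<Sum>k<degree f. of_int (c k) * \<theta> ^ k) = (\<Sum>k\<in>{i, j}. of_int (c k) * \<theta> ^ k)"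
        using ij by (intro sum.mono_neutral_right) (auto simp: c_def)
      also have "\<dots> = 0" using \<open>i \<noteq> j\<close> ij(3) by (simp add: c_def)
      finally show False using *[of c i] ij(1) by (simp add: c_def)
    qed
  qed
  show "int_module.independent ((\<lambda>i. \<theta> ^ i) ` {..<degree f})"
  proof -
    have "u x = 0" if s: "(\<Sum>x\<in>(\<lambda>i. \<theta> ^ i) ` {..<degree f}. of_int (u x) * x) = 0"
      and x: "x \<in> (\<lambda>i. \<theta> ^ i) ` {..<degree f}" for u x
    proof -
    have "(\<Sum>i<degree f. of_int (u (\<theta> ^ i)) * \<theta> ^ i) = 0"
      using s by (simp add: sum.reindex[OF inj])
      then show "u x = 0" using *[of "\<lambda>i. u (\<theta> ^ i)"] x by blast
    qed
    then show ?thesis by (subst int_module.dependent_finite) auto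
  qed
qed

text \<open>Independence of the powers and integrality of Z[\<theta>] hold for every monic
  irreducible f, so only one inclusion is at stake.\<close>

lemma is_int_basis_iff:
  "is_int_basis ((\<lambda>i. \<theta> ^ i) ` {..<degree f}) (ring_of_integers (rat_adjoin \<theta>)) \<longleftrightarrow>
     ring_of_integers (rat_adjoin \<theta>) \<subseteq> range (eval_int \<theta>)"
proof -
  have "range (eval_int \<theta>) \<subseteq> ring_of_integers (rat_adjoin \<theta>)"
    unfolding ring_of_integers_def
    using eval_int_rat_adjoin algebraic_int_eval_int[OF monic degree_pos root] by blast
  then show ?thesis
    unfolding is_int_basis_def span_powers_eq[OF monic root] using independent_powers by auto
qed

text \<open>Bounded denominators of powers are a substitute for integrality that visibly passes to integer
  multiples, so that the closure of algebraic integers under products is not needed.\<close>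

lemma algebraic_int_bounded_powers:
  assumes alg: "algebraic_int z" and N: "N > 0" "of_int N * z = eval_int \<theta> h"
  shows "\<exists>D. D \<noteq> 0 \<and> (\<forall>j. of_int D * z ^ j \<in> range (eval_int \<theta>))"
proof -
  obtain c where c: "eval_int z c = 0" "lead_coeff c = 1"
    using alg unfolding algebraic_int_altdef_ipoly by blast
  define m where "m = degree c"
  have "eval_int z c = (\<Sum>i<m. of_int (coeff c i) * z ^ i) + z ^ m"
    unfolding eval_int_altdef m_def lessThan_Suc_atMost[symmetric] using c(2) by simp
  then have zm: "z ^ m = - (\<Sum>i<m. of_int (coeff c i) * z ^ i)"
    using c(1) by (simp add: eq_neg_iff_add_eq_0 add.commute)
  have R_sum: "(\<Sum>i<k. g i) \<in> range (eval_int \<theta>)"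
    if "\<And>i. i < k \<Longrightarrow> g i \<in> range (eval_int \<theta>)" for g and k :: nat
    using that
  proof (induction k)
    case 0
    show ?case by (auto intro!: range_eqI[of _ _ 0])
  next
    case (Suc k)
    then obtain x y where "(\<Sum>i<k. g i) = eval_int \<theta> x" "g k = eval_int \<theta> y" by fastforce
    then show ?case by (intro range_eqI[of _ _ "x + y"]) (simp only: eval_int_simps sum.lessThan_Suc)
  qed
  \<comment> \<open>With \<open>m\<close> the degree of a monic integer equation of z, N^m clears
    the denominators of all powers up to z^m; the equation expresses higher powers through lower
    ones with integer coefficients, so no further denominators arise.\<close>
  have "of_int (N ^ m) * z ^ j \<in> range (eval_int \<theta>)" for j
  proof (induction j rule: less_induct)
    case (less j)
    show ?case
    proof (cases "j \<le> m")
      case True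
      then have "of_int (N ^ m) * z ^ j = of_int N ^ (m - j) * (of_int N * z) ^ j"
        by (simp add: power_mult_distrib flip: power_add mult.assoc)
      also have "\<dots> = eval_int \<theta> (of_int N ^ (m - j) * h ^ j)"
        unfolding eval_int_simps N(2) ..
      finally show ?thesis by blast
    next
      case False
      then have "z ^ j = z ^ (j - m) * z ^ m" by (simp flip: power_add)
      also have "\<dots> = (\<Sum>i<m. - of_int (coeff c i) * z ^ (j - m + i))"
        unfolding zm by (simp add: sum_distrib_left power_add mult_ac flip: sum_negf)
      finally have "of_int (N ^ m) * z ^ j
          = (\<Sum>i<m. of_int (- coeff c i) * (of_int (N ^ m) * z ^ (j - m + i)))"
        by (simp add: sum_distrib_left mult_ac)
      also have "\<dots> \<in> range (eval_int \<theta>)"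
      proof (rule R_sum)
        fix i assume "i < m"
        then have "j - m + i < j" using False by simp
        then obtain x where "of_int (N ^ m) * z ^ (j - m + i) = eval_int \<theta> x"
          using less.IH by blast
        then show "of_int (- coeff c i) * (of_int (N ^ m) * z ^ (j - m + i)) \<in> range (eval_int \<theta>)"
          by (intro range_eqI[of _ _ "of_int (- coeff c i) * x"]) (simp only: eval_int_simps)
      qed
      finally show ?thesis .
    qed
  qed
  then show ?thesis using N(1) by (intro exI[of _ "N ^ m"]) auto
qed

text \<open>Dedekind's criterion needs a power of p as common denominator. The cofactor
  \<open>D'\<close> of D prime to p is invertible modulo every p^j, so it can be removed.\<close>

lemma bounded_powers_prime_step:
  assumes p: "prime p"
    and reg: "\<And>\<pi>. lead_coeff \<pi> = 1 \<Longrightarrow> prime_ideal2 (of_int p) \<pi> \<Longrightarrow> f \<in> ideal2 (of_int p) \<pi>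
                \<Longrightarrow> f \<notin> ideal2_sq (of_int p) \<pi>"
    and D: "D \<noteq> 0" "\<And>j. of_int D * w ^ j \<in> range (eval_int \<theta>)"
    and h: "of_int p * w = eval_int \<theta> h"
  shows "w \<in> range (eval_int \<theta>)"
proof -
  have p0: "p \<noteq> 0" using p by auto
  obtain D' where D': "D = p ^ multiplicity p D * D'" "\<not> p dvd D'"
    using multiplicity_decompose'[of D p] D(1) p by (metis not_prime_unit)
  have "of_int p ^ multiplicity p D * h ^ j \<in> ideal2 (of_int p ^ j) f" for j
  proof -
    obtain g where g: "of_int D * w ^ j = eval_int \<theta> g" using D(2)[of j] by blast
    have "eval_int \<theta> (of_int D * h ^ j) = of_int p ^ j * (of_int D * w ^ j)"
      unfolding eval_int_simps h[symmetric] by (simp add: power_mult_distrib)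
    also have "\<dots> = eval_int \<theta> (of_int p ^ j * g)" unfolding g eval_int_simps ..
    finally have "f dvd of_int D * h ^ j - of_int p ^ j * g" unfolding eval_int_eq_iff .
    then obtain y where "of_int D * h ^ j - of_int p ^ j * g = f * y" by blast
    then have Dh: "of_int D * h ^ j = of_int p ^ j * g + f * y" by (simp add: algebra_simps)
    have "coprime p D'" using p D'(2) by (rule prime_imp_coprime)
    then have "coprime (p ^ j) D'" by simp
    then have "coprime D' (p ^ j)" by (rule iffD1[OF algebraic_semidom_class.coprime_commute])
    then obtain u where "[D' * u = 1] (mod p ^ j)" using cong_solve_coprime_int by blast
    then obtain v where v: "D' * u - 1 = p ^ j * v" by (auto simp: cong_iff_dvd_diff)
    let ?a = "multiplicity p D"
    have "p ^ ?a = D * u - p ^ j * (v * p ^ ?a)"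
    proof -
      have "D * u - p ^ j * (v * p ^ ?a) = p ^ ?a * (D' * u - p ^ j * v)"
        by (subst D'(1)) (simp add: algebra_simps)
      also have "D' * u - p ^ j * v = 1" using v by simp
      finally show ?thesis by simp
    qed
    then have "of_int p ^ ?a = (of_int D * of_int u - of_int p ^ j * (of_int v * of_int p ^ ?a) :: int poly)"
      by (metis of_int_diff of_int_mult of_int_power)
    then have "of_int p ^ ?a * h ^ j
        = (of_int D * of_int u - of_int p ^ j * (of_int v * of_int p ^ ?a)) * h ^ j"
      by (simp only:)
    also have "\<dots> = of_int u * (of_int D * h ^ j) - of_int p ^ j * (of_int v * of_int p ^ ?a * h ^ j)"
      by (simp add: algebra_simps)
    also have "\<dots> = of_int p ^ j * (of_int u * g - of_int v * of_int p ^ ?a * h ^ j) + f * (of_int u * y)"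
      unfolding Dh by (simp add: algebra_simps)
    finally show ?thesis by (rule ideal2I)
  qed
  then have "h \<in> ideal2 (of_int p) f"
    using reg by (intro dedekind_criterion[OF p monic]) blast+
  then obtain x y where "h = of_int p * x + f * y" by (elim ideal2E)
  then have "of_int p * w = of_int p * eval_int \<theta> x"
    unfolding h by (simp only: eval_int_simps root) simp
  then show ?thesis using p0 by auto
qed

text \<open>The primes of a denominator M of z are removed one at a time. If M = p K, then K z has
  denominator p, and its powers keep the bound \<open>D\<close> found for z.\<close>

theorem ring_of_integers_subset:
  assumes reg: "\<And>p \<pi>. prime p \<Longrightarrow> lead_coeff \<pi> = 1 \<Longrightarrow> prime_ideal2 (of_int p) \<pi> \<Longrightarrow>
     f \<in> ideal2 (of_int p) \<pi> \<Longrightarrow> f \<notin> ideal2_sq (of_int p) \<pi>"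
  shows "ring_of_integers (rat_adjoin \<theta>) \<subseteq> range (eval_int \<theta>)"
proof
  fix z assume "z \<in> ring_of_integers (rat_adjoin \<theta>)"
  then have z: "z \<in> rat_adjoin \<theta>" "algebraic_int z" by (auto simp: ring_of_integers_def)
  obtain N h where N: "N > 0" "of_int N * z = eval_int \<theta> h" using rat_adjoin_denominator[OF z(1)] .
  obtain D where D: "D \<noteq> 0" "\<And>j. of_int D * z ^ j \<in> range (eval_int \<theta>)"
    using algebraic_int_bounded_powers[OF z(2) N] by blast
  have "M > 0 \<Longrightarrow> of_nat M * z \<in> range (eval_int \<theta>) \<Longrightarrow> z \<in> range (eval_int \<theta>)" for M
  proof (induction M rule: less_induct)
    case (less M)
    show ?case
    proof (cases "M = 1")
      case True
      then show ?thesis using less.prems by simp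
    next
      case False
      then obtain p where p: "prime p" "p dvd M" using prime_factor_nat by blast
      then obtain K where M: "M = p * K" by blast
      have K: "K > 0" "K < M" using less.prems(1) prime_gt_1_nat[OF p(1)] by (auto simp: M)
      obtain g where g: "of_nat M * z = eval_int \<theta> g" using less.prems(2) by blast
      have "of_nat K * z \<in> range (eval_int \<theta>)"
      proof (rule bounded_powers_prime_step[OF _ reg D(1)])
        show "prime (int p)" using p(1) by simp
        show "of_int (int p) * (of_nat K * z) = eval_int \<theta> g" using g by (simp add: M mult_ac)
        fix j
        obtain x where "of_int D * z ^ j = eval_int \<theta> x" using D(2) by blast
        then have "of_int D * (of_nat K * z) ^ j = eval_int \<theta> (of_int (int K ^ j) * x)"
          unfolding eval_int_simps by (simp add: power_mult_distrib mult_ac)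
        then show "of_int D * (of_nat K * z) ^ j \<in> range (eval_int \<theta>)" by blast
      qed (use p(1) in simp_all)
      with less.IH[OF K(2,1)] show ?thesis by blast
    qed
  qed
  from this[of "nat N"] N show "z \<in> range (eval_int \<theta>)" by auto
qed

end

section \<open>Eisenstein's criterion and binomial congruences\<close>

text \<open>At the first index \<open>i\<close> where p does not divide the coefficient of g, the
  product has coefficient congruent to g_i h_0 modulo p. So deg(g h) <= i <= deg g.\<close>

lemma eisenstein_aux:
  fixes g h :: "int poly"
  assumes p: "prime p" and low: "\<And>i. i < degree (g * h) \<Longrightarrow> p dvd coeff (g * h) i"
    and g0: "p dvd coeff g 0" and h0: "\<not> p dvd coeff h 0" and lc: "\<not> p dvd lead_coeff g"
    and nz: "g \<noteq> 0" "h \<noteq> 0"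
  shows "degree h = 0"
proof -
  define i where "i = (LEAST i. \<not> p dvd coeff g i)"
  have i: "\<not> p dvd coeff g i" unfolding i_def by (rule LeastI, rule lc)
  have less: "p dvd coeff g k" if "k < i" for k using not_less_Least[OF that[unfolded i_def]] by simp
  have "i \<le> degree g" using i by (auto intro: ccontr simp: not_le coeff_eq_0)
  have "coeff (g * h) i = (\<Sum>k<i. coeff g k * coeff h (i - k)) + coeff g i * coeff h 0"
    by (simp add: coeff_mult flip: lessThan_Suc_atMost)
  moreover have "p dvd (\<Sum>k<i. coeff g k * coeff h (i - k))" using less by (intro dvd_sum) auto
  moreover have "\<not> p dvd coeff g i * coeff h 0" using i h0 p by (simp add: prime_dvd_mult_iff)
  ultimately have "\<not> p dvd coeff (g * h) i" by (simp add: dvd_add_right_iff)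
  then have "degree (g * h) \<le> i" using low not_less by blast
  with \<open>i \<le> degree g\<close> show ?thesis using nz by (simp add: degree_mult_eq)
qed

theorem eisenstein:
  fixes f :: "int poly"
  assumes p: "prime p" and f: "lead_coeff f = 1" "degree f > 0"
    and low: "\<And>i. i < degree f \<Longrightarrow> p dvd coeff f i" and sq: "\<not> p\<^sup>2 dvd coeff f 0"
  shows "irreducible (map_poly rat_of_int f)"
proof (rule irreducibleI)
  show "map_poly rat_of_int f \<noteq> 0" using f by auto
  show "\<not> is_unit (map_poly rat_of_int f)" using f(2) by (simp add: is_unit_iff_degree)
  fix g h assume "map_poly rat_of_int f = g * h"
  from rat_to_int_factor[OF this] obtain g' h' where
    f': "f = g' * h'" and deg: "degree g' = degree g" "degree h' = degree h" by blast
  have nz: "g' \<noteq> 0" "h' \<noteq> 0" "g \<noteq> 0" "h \<noteq> 0" using f' f(1) \<open>map_poly rat_of_int f = g * h\<close> by auto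
  have "lead_coeff g' * lead_coeff h' = 1" using f(1) by (simp add: f' lead_coeff_mult)
  then have "is_unit (lead_coeff g')" "is_unit (lead_coeff h')" by (metis dvd_triv_left dvd_triv_right)+
  then have lc: "\<not> p dvd lead_coeff g'" "\<not> p dvd lead_coeff h'"
    using p by (meson dvd_trans not_prime_unit dvd_trans)+
  have c0: "coeff f 0 = coeff g' 0 * coeff h' 0" by (simp add: f' coeff_mult)
  have "p dvd coeff f 0" using low f(2) by simp
  then have "p dvd coeff g' 0 \<or> p dvd coeff h' 0" using p by (simp add: c0 prime_dvd_mult_iff)
  moreover have "\<not> (p dvd coeff g' 0 \<and> p dvd coeff h' 0)"
    using sq by (auto simp: c0 power2_eq_square mult_dvd_mono)
  ultimately consider "p dvd coeff g' 0" "\<not> p dvd coeff h' 0" | "p dvd coeff h' 0" "\<not> p dvd coeff g' 0"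
    by blast
  then have "degree h' = 0 \<or> degree g' = 0"
  proof cases
    case 1
    then show ?thesis using eisenstein_aux[OF p low[unfolded f']] lc nz by auto
  next
    case 2
    then show ?thesis using eisenstein_aux[OF p low[unfolded f' mult.commute[of g' h']]] lc nz by auto
  qed
  then show "is_unit g \<or> is_unit h"
    using deg is_unit_iff_degree[OF nz(3)] is_unit_iff_degree[OF nz(4)] by auto
qed

text \<open>The middle binomial coefficients are multiples of p. The factor x y is kept explicit
  because the non-maximal case needs the term p s A with its factor s.\<close>

lemma freshman_prime:
  fixes x y :: "'a::comm_ring_1"
  assumes p: "prime p"
  obtains B where "(x + y) ^ p = x ^ p + y ^ p + of_nat p * x * y * B"
proof -
  obtain r where r: "p = Suc (Suc r)" using prime_ge_2_nat[OF p] by (metis One_nat_def Suc_1 Suc_le_D le_Suc_ex add_2_eq_Suc)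
  have ch: "of_nat (p choose Suc k) = (of_nat p * of_nat ((p choose Suc k) div p) :: 'a)" if "k < Suc r" for k
  proof -
    have "p dvd p choose Suc k" using that r p by (intro dvd_choose_prime) auto
    then show ?thesis by (metis dvd_mult_div_cancel of_nat_mult)
  qed
  have "(x + y) ^ p = (\<Sum>k\<le>p. of_nat (p choose k) * x ^ k * y ^ (p - k))" by (rule binomial_ring)
  also have "\<dots> = y ^ p + (\<Sum>k<Suc r. of_nat (p choose Suc k) * x ^ Suc k * y ^ (p - Suc k)) + x ^ p"
    unfolding lessThan_Suc_atMost[symmetric]
    by (subst sum.lessThan_Suc, subst (2) r, subst sum.lessThan_Suc_shift) simp
  also have "(\<Sum>k<Suc r. of_nat (p choose Suc k) * x ^ Suc k * y ^ (p - Suc k))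
     = of_nat p * x * y * (\<Sum>k<Suc r. of_nat ((p choose Suc k) div p) * x ^ k * y ^ (r - k))"
    unfolding sum_distrib_left
  proof (rule sum.cong)
    fix k assume k: "k \<in> {..<Suc r}"
    then have "p - Suc k = Suc (r - k)" by (auto simp: r)
    then show "of_nat (p choose Suc k) * x ^ Suc k * y ^ (p - Suc k)
      = of_nat p * x * y * (of_nat ((p choose Suc k) div p) * x ^ k * y ^ (r - k))"
      using k by (simp add: ch mult_ac)
  qed simp
  finally have "(x + y) ^ p = x ^ p + y ^ p + of_nat p * x * y *
      (\<Sum>k<Suc r. of_nat ((p choose Suc k) div p) * x ^ k * y ^ (r - k))" by (simp add: add_ac)
  then show thesis by (rule that)
qed

lemma power_add_mod_square:
  fixes a u :: "'a::comm_ring_1"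
  obtains t where "(u + a) ^ k = a ^ k + of_nat k * a ^ (k - 1) * u + u\<^sup>2 * t"
proof -
  have "\<exists>t. (u + a) ^ k = a ^ k + of_nat k * a ^ (k - 1) * u + u\<^sup>2 * t"
  proof (induction k)
    case 0
    show ?case by (rule exI[of _ 0]) simp
  next
    case (Suc k)
    then obtain t where t: "(u + a) ^ k = a ^ k + of_nat k * a ^ (k - 1) * u + u\<^sup>2 * t" by blast
    have 2: "of_nat k * a ^ k = of_nat k * a ^ (k - 1) * a" by (cases k) auto
    have "(u + a) ^ Suc k = a ^ Suc k + of_nat (Suc k) * a ^ (Suc k - 1) * u
       + u\<^sup>2 * (of_nat k * a ^ (k - 1) + t * (u + a))"
    proof -
      have "(u + a) ^ Suc k = (a ^ k + of_nat k * a ^ (k - 1) * u + u\<^sup>2 * t) * (u + a)"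
        by (simp only: power_Suc2 t)
      also have "\<dots> = a ^ Suc k + a ^ k * u + (of_nat k * a ^ (k - 1) * a) * u
          + u\<^sup>2 * (of_nat k * a ^ (k - 1) + t * (u + a))"
        by (simp add: algebra_simps power2_eq_square)
      also have "\<dots> = a ^ Suc k + of_nat (Suc k) * a ^ (Suc k - 1) * u
          + u\<^sup>2 * (of_nat k * a ^ (k - 1) + t * (u + a))"
        unfolding 2[symmetric] by (simp add: algebra_simps)
      finally show ?thesis .
    qed
    then show ?case by blast
  qed
  then show thesis using that by blast
qed

text \<open>For $L = (n+1)Mx + nc$, the left-hand side is, up to the constant term, a multiple of the
  trinomial $M x^{n+1} + c x^n - b$, whose derivative is $x^{n-1} L$. The linear term in $L$ cancels,
  so modulo the square of a prime containing $L$ only the discriminant remains.\<close>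

lemma discriminant_expansion_mod_square:
  fixes L c :: "'a::comm_ring_1"
  assumes n: "n > 0"
  obtains T where "(L - of_nat n * c) ^ n * (L + c) = (- (of_nat n * c)) ^ n * c + L\<^sup>2 * T"
proof -
  let ?a = "- (of_nat n * c)"
  obtain t where t: "(L + ?a) ^ n = ?a ^ n + of_nat n * ?a ^ (n - 1) * L + L\<^sup>2 * t"
    by (rule power_add_mod_square)
  have e: "of_nat n * c * ?a ^ (n - 1) = - (?a ^ n)" using n by (cases n) (simp_all add: algebra_simps)
  have "(L - of_nat n * c) ^ n * (L + c) = (?a ^ n + of_nat n * ?a ^ (n - 1) * L + L\<^sup>2 * t) * (L + c)"
    using t by simp
  also have "\<dots> = ?a ^ n * c + ?a ^ n * L + (of_nat n * c * ?a ^ (n - 1)) * L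
      + L\<^sup>2 * (of_nat n * ?a ^ (n - 1) + t * (L + c))"
    by (simp add: ring_distribs power2_eq_square mult_ac add_ac)
  also have "\<dots> = ?a ^ n * c + L\<^sup>2 * (of_nat n * ?a ^ (n - 1) + t * (L + c))"
    unfolding e by simp
  finally show thesis by (rule that)
qed

lemma pderiv_of_int_mult: "pderiv (of_int c * g) = of_int c * pderiv g"
  by (simp add: of_int_poly pderiv_smult)

lemma pderiv_of_int: "pderiv (of_int c) = 0"
  by (simp add: of_int_poly pderiv_pCons)


section \<open>Arithmetic of a fixed prime ideal (p, \<pi>) with \<pi> monic\<close>

locale prime_over =
  fixes p :: int and \<pi> :: "int poly"
  assumes p: "prime p" and \<pi>: "lead_coeff \<pi> = 1" and prime: "prime_ideal2 (of_int p) \<pi>"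
begin

abbreviation P where "P \<equiv> ideal2 (of_int p) \<pi>"
abbreviation P2 where "P2 \<equiv> ideal2_sq (of_int p) \<pi>"

lemma prime_mult: "x * y \<in> P \<Longrightarrow> x \<in> P \<or> y \<in> P"
  using prime by (simp add: prime_ideal2_def)

lemma one_notin_P: "1 \<notin> P"
  using prime by (simp add: prime_ideal2_def)

lemma of_int_P: "of_int c \<in> P \<Longrightarrow> p dvd c"
  by (rule of_int_mem_ideal2[OF p one_notin_P])

lemma of_int_P2: "of_int c \<in> P2 \<Longrightarrow> p\<^sup>2 dvd c"
  by (rule of_int_mem_ideal2_sq[OF p \<pi> one_notin_P])

lemma dvd_P: "p dvd c \<Longrightarrow> of_int c \<in> P"
  by auto

lemma dvd_P2:
  assumes "p\<^sup>2 dvd c" shows "of_int c \<in> P2"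
proof -
  from assms obtain d where "c = p\<^sup>2 * d" by blast
  then show ?thesis by (intro ideal2_sqI[of _ _ "of_int d" _ 0 0]) simp
qed

text \<open>By the product rule, differentiating a product of two elements of P leaves one factor in
  P in each term, up to the constant p, whose derivative vanishes.\<close>

lemma pderiv_P2:
  assumes "x \<in> P2" shows "pderiv x \<in> P"
proof -
  obtain s t u where x: "x = (of_int p)\<^sup>2 * s + of_int p * \<pi> * t + \<pi>\<^sup>2 * u"
    using assms by (rule ideal2_sqE)
  have "x = of_int p * (of_int p * s + \<pi> * t) + \<pi> * (\<pi> * u)"
    by (simp add: x power2_eq_square algebra_simps)
  then have "pderiv x = pderiv (of_int p * (of_int p * s + \<pi> * t) + \<pi> * (\<pi> * u))" by (rule arg_cong)
  also have "\<dots> = of_int p * pderiv (of_int p * s + \<pi> * t) + (\<pi> * pderiv (\<pi> * u) + \<pi> * u * pderiv \<pi>)"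
    by (simp only: pderiv_add pderiv_of_int_mult pderiv_mult[of \<pi> "\<pi> * u"])
  also have "\<dots> = of_int p * pderiv (of_int p * s + \<pi> * t) + \<pi> * (pderiv (\<pi> * u) + u * pderiv \<pi>)"
    by (simp only: distrib_left mult.assoc)
  finally show ?thesis by (rule ideal2I)
qed

lemma power_P: "x ^ k \<in> P \<Longrightarrow> x \<in> P"
  using prime by (rule prime_ideal2_power)

end

section \<open>The polynomials $\mathcal{F}_{n,b,m,1}$\<close>

definition X :: "int poly" where "X = [:0, 1:]"

lemma pderiv_X: "pderiv X = 1"
  by (simp add: X_def pderiv_pCons)

lemma pderiv_X_power: "pderiv (X ^ k) = of_nat k * X ^ (k - 1)"
  by (cases k) (simp_all add: pderiv_power_Suc pderiv_X of_nat_poly del: of_nat_Suc power_Suc)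

lemma of_int_mult_X_power: "of_int c * X ^ k = monom c k"
  by (simp add: X_def monom_altdef of_int_poly)

lemma F_poly_altdef: "F_poly n b m = X ^ n + of_int b * (\<Sum>i<n. (of_int (m\<^sup>2) * X) ^ i)"
proof -
  have "monom 1 n = X ^ n" by (simp add: X_def monom_altdef)
  moreover have "(\<Sum>j=1..n. [:0, m\<^sup>2:] ^ (n - j)) = (\<Sum>i<n. (of_int (m\<^sup>2) * X) ^ i)"
    by (rule sum.reindex_bij_witness[of _ "\<lambda>i. n - i" "\<lambda>j. n - j"]) (auto simp: of_int_poly X_def)
  ultimately show ?thesis by (simp add: F_poly_def of_int_poly)
qed

lemma coeff_F_poly:
  "coeff (F_poly n b m) i = (if i = n then 1 else if i < n then b * m ^ (2 * i) else 0)"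
proof -
  have "F_poly n b m = monom 1 n + of_int b * (\<Sum>i<n. monom (m ^ (2 * i)) i)"
    unfolding F_poly_altdef power_mult_distrib of_int_power[symmetric] of_int_mult_X_power
    using of_int_mult_X_power[of 1 n] by (simp add: power_mult)
  then show ?thesis by (simp add: of_int_poly coeff_sum)
qed

lemma degree_F_poly: "degree (F_poly n b m) = n"
  by (rule antisym; (rule degree_le | rule le_degree)) (auto simp: coeff_F_poly)

lemma lead_coeff_F_poly: "lead_coeff (F_poly n b m) = 1"
  by (simp add: degree_F_poly coeff_F_poly)

lemma F_poly_mult:
  "(of_int (m\<^sup>2) * X - 1) * F_poly n b m
    = of_int (m\<^sup>2) * X ^ (n + 1) + of_int (b * m ^ (2 * n) - 1) * X ^ n - of_int b"
proof -
  define Y where "Y = of_int (m\<^sup>2) * X"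
  define S where "S = (\<Sum>i<n. Y ^ i)"
  have S: "(Y - 1) * S = Y ^ n - 1" unfolding S_def by (rule power_diff_1_eq[symmetric])
  have Yn: "Y ^ n = of_int (m ^ (2 * n)) * X ^ n"
    unfolding Y_def by (simp only: power_mult_distrib of_int_power power_mult)
  have "(Y - 1) * F_poly n b m = (Y - 1) * X ^ n + of_int b * ((Y - 1) * S)"
    unfolding F_poly_altdef Y_def[symmetric] S_def[symmetric] by (simp add: algebra_simps)
  also have "\<dots> = of_int (m\<^sup>2) * X ^ (n + 1) + of_int (b * m ^ (2 * n) - 1) * X ^ n - of_int b"
    unfolding S Yn unfolding Y_def by (simp add: algebra_simps)
  finally show ?thesis unfolding Y_def .
qed

text \<open>All terms besides X^n and b contain b m^2 X, so they vanish modulo b, modulo X, and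
  modulo p^2 when p | m.\<close>

lemma F_poly_const:
  assumes "n > 0" obtains g where "F_poly n b m = X ^ n + of_int b + of_int (b * m\<^sup>2) * X * g"
proof -
  obtain k where n: "n = Suc k" using assms by (cases n) auto
  define Y where "Y = of_int (m\<^sup>2) * X"
  define S where "S = (\<Sum>i<k. Y ^ i)"
  have "(\<Sum>i<n. Y ^ i) = 1 + Y * S"
    unfolding n S_def by (subst sum.lessThan_Suc_shift) (simp add: sum_distrib_left)
  then have "F_poly n b m = X ^ n + of_int b + of_int (b * m\<^sup>2) * X * S"
    unfolding F_poly_altdef Y_def[symmetric] by (simp add: Y_def algebra_simps)
  then show thesis by (rule that)
qed

lemma irreducible_F_poly:
  assumes n: "n > 0" and b: "b \<ge> 2" "squarefree b"
  shows "irreducible (map_poly rat_of_int (F_poly n b m))"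
proof -
  obtain q where q: "prime q" "q dvd b" using prime_divisor_exists[of b] b(1) by auto
  show ?thesis
  proof (rule eisenstein[OF q(1)])
    show "\<not> q\<^sup>2 dvd coeff (F_poly n b m) 0"
      using n b(2) q(1) by (auto simp: coeff_F_poly dest: squarefreeD)
  qed (use n q(2) in \<open>auto simp: degree_F_poly coeff_F_poly\<close>)
qed

text \<open>The case where the division by $(1 + bm^{2n}n)^2$ could remove factors \<open>p\<close>: with $y = n + 1$
  and $u = 1 + cn$, the numerator is $\frac{1}{n}((y-u)^y - y^y + u y^y)$, and in its binomial
  expansion only terms $u^k y^{y-k}$ with $k \ge 2$ survive.\<close>

lemma square_dvd_D_quot:
  assumes p: "prime p" and n: "n \<ge> 3"
    and u: "p dvd 1 + c * int n" "1 + c * int n \<noteq> 0" and dn: "p dvd int n + 1"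
    and D: "int n ^ n * (1 - c) ^ (n + 1) + c * (int n + 1) ^ (n + 1) = (1 + c * int n)\<^sup>2 * D"
  shows "p\<^sup>2 dvd D"
proof -
  define u where "u = 1 + c * int n"
  define z where "z = int n + 1"
  let ?y = "n + 1"
  let ?t = "\<lambda>k. of_nat (?y choose k) * (- u) ^ k * z ^ (?y - k)"
  let ?S = "\<Sum>k=2..?y. of_nat (?y choose k) * (- u) ^ (k - 2) * z ^ (?y - k)"
  have "(z - u) ^ ?y = (- u + z) ^ ?y" by simp
  also have "\<dots> = (\<Sum>k\<le>?y. ?t k)" by (rule binomial_ring)
  also have "{..?y} = {0, 1} \<union> {2..?y}" by auto
  also have "(\<Sum>k\<in>\<dots>. ?t k) = (\<Sum>k\<in>{0, 1}. ?t k) + (\<Sum>k\<in>{2..?y}. ?t k)"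
    by (rule sum.union_disjoint) auto
  also have "(\<Sum>k\<in>{0, 1}. ?t k) = z ^ ?y - u * z ^ ?y" by (simp add: z_def algebra_simps)
  also have "(\<Sum>k\<in>{2..?y}. ?t k) = u\<^sup>2 * ?S"
    unfolding sum_distrib_left
  proof (rule sum.cong)
    fix k assume "k \<in> {2..?y}"
    then have "(- u) ^ k = u\<^sup>2 * (- u) ^ (k - 2)"
      by (metis atLeastAtMost_iff le_add_diff_inverse power2_minus power_add)
    then show "?t k = u\<^sup>2 * (of_nat (?y choose k) * (- u) ^ (k - 2) * z ^ (?y - k))"
      by (simp only: mult_ac)
  qed simp
  finally have e: "(z - u) ^ ?y = z ^ ?y - u * z ^ ?y + u\<^sup>2 * ?S" .
  have "z - u = int n * (1 - c)" by (simp add: z_def u_def algebra_simps)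
  then have "int n * (int n ^ n * (1 - c) ^ ?y) = (z - u) ^ ?y"
    by (simp add: power_mult_distrib)
  then have "int n * (int n ^ n * (1 - c) ^ ?y + c * z ^ ?y) = (z - u) ^ ?y + (c * int n) * z ^ ?y"
    by (simp only: distrib_left mult_ac)
  also have "c * int n = u - 1" by (simp add: u_def)
  finally have "int n * (int n ^ n * (1 - c) ^ ?y + c * z ^ ?y) = u\<^sup>2 * ?S"
    unfolding e by (simp add: algebra_simps)
  then have "u\<^sup>2 * (int n * D) = u\<^sup>2 * ?S"
    using D unfolding u_def[symmetric] z_def[symmetric] by (simp add: mult_ac)
  then have nD: "int n * D = ?S" using u(2) by (simp add: u_def)
  have "p\<^sup>2 dvd ?S"
  proof (rule dvd_sum)
    fix k assume k: "k \<in> {2..?y}"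
    have "p dvd - u" "p dvd z" using u(1) dn by (simp_all only: u_def z_def dvd_minus_iff)
    then have "p ^ (k - 2) * p ^ (?y - k) dvd (- u) ^ (k - 2) * z ^ (?y - k)"
      by (intro mult_dvd_mono dvd_power_same)
    \<comment> \<open>The exponents add up to n - 1, which is at least 2 since n >= 3.\<close>
    moreover have "p\<^sup>2 dvd p ^ (k - 2) * p ^ (?y - k)"
      unfolding power_add[symmetric] using k n by (intro le_imp_power_dvd) auto
    ultimately show "p\<^sup>2 dvd of_nat (?y choose k) * (- u) ^ (k - 2) * z ^ (?y - k)"
      by (metis dvd_mult dvd_trans mult.assoc)
  qed
  then have "p\<^sup>2 dvd int n * D" by (simp only: nD)
  moreover have "coprime p (int n)"
  proof (rule prime_imp_coprime[OF p])
    show "\<not> p dvd int n"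
      using dn p by (metis dvd_add_right_iff not_prime_unit)
  qed
  ultimately show ?thesis by (simp add: coprime_dvd_mult_right_iff)
qed

section \<open>F lies in no P^2, according to which of b and m are divisible by p\<close>

context prime_over
begin

lemma X_not_in_P:
  assumes n: "n > 0" and b: "\<not> p dvd b" and F: "F_poly n b m \<in> P"
  shows "X \<notin> P"
proof
  assume X: "X \<in> P"
  obtain g where g: "F_poly n b m = X ^ n + of_int b + of_int (b * m\<^sup>2) * X * g"
    using F_poly_const[OF n] .
  have "of_int b = F_poly n b m - X * (X ^ (n - 1) + of_int (b * m\<^sup>2) * g)"
    using n by (simp only: g) (cases n; simp add: algebra_simps)
  then have "of_int b \<in> P" using F X by (simp only: ideal2_diff ideal2_mult')
  with of_int_P b show False by blast
qed

lemma F_poly_regular_dvd_b: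
  assumes n: "n \<ge> 2" and b: "p dvd b" "\<not> p\<^sup>2 dvd b"
  shows "F_poly n b m \<notin> P2"
proof
  assume F2: "F_poly n b m \<in> P2"
  then have F: "F_poly n b m \<in> P" by (rule ideal2_sq_subset)
  have n0: "n > 0" using n by simp
  obtain g where g: "F_poly n b m = X ^ n + of_int b + of_int (b * m\<^sup>2) * X * g"
    using F_poly_const[OF n0] .
  have bP: "of_int b \<in> P" using b(1) by (rule dvd_P)
  have "X ^ n = F_poly n b m - of_int b * (1 + of_int (m\<^sup>2) * X * g)"
    by (simp only: g of_int_mult) (simp only: algebra_simps)
  then have "X ^ n \<in> P" using F bP by (simp only: ideal2_diff ideal2_mult')
  then have X: "X \<in> P" by (rule power_P)
  \<comment> \<open>As X and b lie in P, both X^n and b X lie in P^2, which isolates the constant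
    term b.\<close>
  have "X ^ n = X ^ (n - 2) * (X * X)" using n by (metis le_add_diff_inverse2 power2_eq_square power_add)
  then have "of_int b = F_poly n b m - X ^ (n - 2) * (X * X) - (of_int (m\<^sup>2) * g) * (of_int b * X)"
    by (simp only: g of_int_mult) (simp only: algebra_simps)
  also have "\<dots> \<in> P2" using F2 X bP by (intro ideal2_sq_diff ideal2_sq_mult ideal2_sq_prod)
  finally show False using of_int_P2 b(2) by blast
qed

lemma F_poly_regular_dvd_m:
  assumes n: "n \<ge> 2" and b0: "b \<ge> 0" and b: "\<not> p dvd b" and m: "p dvd m"
    and cond: "p dvd int n \<Longrightarrow> \<not> p\<^sup>2 dvd (- b) ^ nat p + b"
  shows "F_poly n b m \<notin> P2"
proof
  assume F2: "F_poly n b m \<in> P2"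
  then have F: "F_poly n b m \<in> P" by (rule ideal2_sq_subset)
  have n0: "n > 0" using n by simp
  have XP: "X \<notin> P" using X_not_in_P[OF n0 b F] .
  obtain g where g: "F_poly n b m = X ^ n + of_int b + of_int (b * m\<^sup>2) * X * g"
    using F_poly_const[OF n0] .
  have "X ^ n + of_int b = F_poly n b m - X * g * of_int (b * m\<^sup>2)"
    by (simp only: g algebra_simps)
  also have "\<dots> \<in> P2" using F2 m by (intro ideal2_sq_diff ideal2_sq_mult dvd_P2) auto
  finally have E2: "X ^ n + of_int b \<in> P2" .
  show False
  proof (cases "p dvd int n")
    case False
    have "pderiv (X ^ n + of_int b) = of_int (int n) * X ^ (n - 1)"
      by (simp only: pderiv_add pderiv_of_int pderiv_X_power of_int_of_nat_eq add_0_right)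
    with pderiv_P2[OF E2] have "of_int (int n) * X ^ (n - 1) \<in> P" by (simp only:)
    then show False using prime_mult of_int_P power_P False XP by blast
  next
    case True
    define q where "q = nat p"
    have p_eq: "p = int q" using p by (simp add: q_def prime_ge_0_int)
    have q: "prime q" using p by (simp add: p_eq)
    from True obtain t where t: "n = q * t" by (auto simp: p_eq)
    define s where "s = X ^ t + of_int b"
    obtain a where a: "b = int a" using b0 nonneg_int_cases by blast
    have "[a ^ (q - 1) = 1] (mod q)"
      using b by (intro fermat_theorem q) (simp add: a p_eq)
    then have "[int (a ^ (q - 1)) = int 1] (mod int q)" by (simp only: cong_int_iff)
    then have "[b ^ (q - 1) = 1] (mod p)" by (simp add: p_eq a)
    moreover have "b ^ q - b = b * (b ^ (q - 1) - 1)"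
      using q by (cases q) (simp_all add: algebra_simps)
    ultimately have fermat: "p dvd b ^ q - b" by (simp add: cong_iff_dvd_diff)
    obtain B where B: "s ^ q = (X ^ t) ^ q + of_int b ^ q + of_nat q * X ^ t * of_int b * B"
      unfolding s_def by (rule freshman_prime[OF q])
    \<comment> \<open>Fermat replaces b^q by b modulo p, so s^q agrees with X^n + b and
      \<open>s\<close> itself lies in P.\<close>
    have "s ^ q = (X ^ n + of_int b) + of_int (b ^ q - b) + of_int p * (X ^ t * of_int b * B)"
      unfolding B by (simp add: t p_eq power_mult mult_ac flip: power_mult)
    also have "\<dots> \<in> P" using E2 fermat
      by (intro ideal2_add ideal2_gen1 dvd_P ideal2_sq_subset)
    finally have s: "s \<in> P" by (rule power_P)
    \<comment> \<open>Expanding around -b, the linear term carries the factor p s and the rest s^2,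
      both in P^2; only the integer (-b)^q + b survives.\<close>
    obtain T where T: "(s + of_int (- b)) ^ q
        = of_int (- b) ^ q + of_nat q * of_int (- b) ^ (q - 1) * s + s\<^sup>2 * T"
      by (rule power_add_mod_square)
    have "X ^ n = (X ^ t) ^ q" by (simp only: t mult.commute[of q t] power_mult)
    then have "X ^ n = (s + of_int (- b)) ^ q" by (simp add: s_def)
    then have "of_int ((- b) ^ q + b) = (X ^ n + of_int b)
        - of_int (- b) ^ (q - 1) * (of_int p * s) - T * (s * s)"
      unfolding T by (simp add: p_eq power2_eq_square mult_ac)
    also have "\<dots> \<in> P2" using E2 s
      by (intro ideal2_sq_diff ideal2_sq_mult ideal2_sq_prod) (auto intro: dvd_P)
    finally have "p\<^sup>2 dvd (- b) ^ q + b" by (rule of_int_P2)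
    with cond[OF True] show False by (simp add: q_def)
  qed
qed

end

context prime_over
begin

lemma F_poly_regular_coprime:
  assumes n: "n \<ge> 3" and b0: "b \<ge> 0" and b: "\<not> p dvd b" and m: "\<not> p dvd m"
    and D: "\<not> p\<^sup>2 dvd D_quot n b m"
  shows "F_poly n b m \<notin> P2"
proof
  assume F2: "F_poly n b m \<in> P2"
  define M where "M = m\<^sup>2"
  define e where "e = b * m ^ (2 * n)"
  define c where "c = e - 1"
  define u where "u = 1 + e * int n"
  define N where "N = int n ^ n * (1 - e) ^ (n + 1) + e * (int n + 1) ^ (n + 1)"
  define F where "F = F_poly n b m"
  define H where "H = of_int M * X - 1"
  define G where "G = H * F"
  define L where "L = of_int (M * (int n + 1)) * X + of_int (int n * c)"
  have eM: "e = b * M ^ n" by (simp add: e_def M_def power_mult)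
  have "e \<ge> 0" using b0 by (simp add: e_def)
  then have u0: "u > 0" by (simp add: u_def add_pos_nonneg)
  have "u\<^sup>2 dvd N" unfolding u_def N_def by (rule D_quot_dvd)
  then have N: "N = u\<^sup>2 * D_quot n b m"
    by (simp add: D_quot_def N_def u_def e_def mult_ac)
  have FP2: "F \<in> P2" and FP: "F \<in> P" using F2 by (auto simp: F_def intro: ideal2_sq_subset)
  have XP: "X \<notin> P" using X_not_in_P[of n b m] n b FP by (simp add: F_def)
  have G: "G = of_int M * X ^ (n + 1) + of_int c * X ^ n - of_int b"
    unfolding G_def H_def F_def M_def F_poly_mult c_def e_def ..
  have GP2: "G \<in> P2" unfolding G_def using FP2 by (rule ideal2_sq_mult)
  have "pderiv G = of_int M * (of_nat (n + 1) * X ^ n) + of_int c * (of_nat n * X ^ (n - 1))"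
    unfolding G by (simp only: pderiv_add pderiv_diff pderiv_of_int pderiv_of_int_mult pderiv_X_power) simp
  also have "X ^ n = X ^ (n - 1) * X" using n by (cases n) simp_all
  also have "of_int M * (of_nat (n + 1) * (X ^ (n - 1) * X)) + of_int c * (of_nat n * X ^ (n - 1))
      = X ^ (n - 1) * L"
    by (simp add: L_def algebra_simps)
  finally have dG: "pderiv G = X ^ (n - 1) * L" .
  have LP: "L \<in> P" using pderiv_P2[OF GP2] prime_mult power_P XP unfolding dG by blast
  obtain T where T: "(L - of_nat n * of_int c) ^ n * (L + of_int c)
      = (- (of_nat n * of_int c)) ^ n * of_int c + L\<^sup>2 * T"
    using discriminant_expansion_mod_square[of n L "of_int c"] n by auto
  have "of_int (M ^ n * (int n + 1) ^ (n + 1)) * G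
      = (L - of_nat n * of_int c) ^ n * (L + of_int c) - of_int (e * (int n + 1) ^ (n + 1))"
  proof -
    define K where "K = int n + 1"
    define Z where "Z = of_int (M * K) * X"
    have L1: "L - of_nat n * of_int c = Z" "L + of_int c = Z + of_int (K * c)"
      by (simp_all add: L_def Z_def K_def algebra_simps)
    have "Z ^ n = of_int (M ^ n) * of_int (K ^ n) * X ^ n"
      by (simp add: Z_def power_mult_distrib)
    then show ?thesis unfolding L1 G eM K_def[symmetric]
      by (simp add: Z_def algebra_simps)
  qed
  also have "\<dots> = L * L * T + of_int ((- (int n * c)) ^ n * c - e * (int n + 1) ^ (n + 1))"
    unfolding T by (simp add: power2_eq_square)
  also have "(- (int n * c)) ^ n * c - e * (int n + 1) ^ (n + 1) = - N"
  proof -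
    have "- (int n * c) = int n * (1 - e)" by (simp add: c_def algebra_simps)
    then have "(- (int n * c)) ^ n = int n ^ n * (1 - e) ^ n" by (simp only: power_mult_distrib)
    moreover have "(1 - e) ^ (n + 1) = - ((1 - e) ^ n * c)" by (simp add: c_def algebra_simps)
    ultimately show ?thesis by (simp add: N_def)
  qed
  finally have "of_int N = T * (L * L) - of_int (M ^ n * (int n + 1) ^ (n + 1)) * G"
    by (simp add: mult_ac)
  also have "\<dots> \<in> P2" using LP GP2 by (intro ideal2_sq_diff ideal2_sq_mult ideal2_sq_prod)
  finally have pN: "p\<^sup>2 dvd N" by (rule of_int_P2)
  show False
  proof (cases "p dvd u")
    case False
    then have "coprime p u" using p by (simp add: prime_imp_coprime)
    then have "coprime (p\<^sup>2) (u\<^sup>2)" by simp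
    then show False using pN D unfolding N by (simp add: coprime_dvd_mult_right_iff)
  next
    case pu: True
    show False
    proof (cases "p dvd int n + 1")
      case True
      have "p\<^sup>2 dvd D_quot n b m"
        using square_dvd_D_quot[OF p n, of e] pu u0 True N unfolding u_def N_def by simp
      with D show False by contradiction
    next
      case False
      \<comment> \<open>Here $H = m^2x - 1$ lies in \<open>P\<close>, so $G = HF \in P^3$ and $G'' \in P$.\<close>
      have "of_int (int n + 1) * H = L - of_int u"
        by (simp add: H_def L_def u_def c_def algebra_simps)
      also have "\<dots> \<in> P" using LP pu by (intro ideal2_diff dvd_P)
      finally have HP: "H \<in> P" using prime_mult of_int_P False by blast
      have dH: "pderiv H = of_int M"
        unfolding H_def by (simp only: pderiv_diff pderiv_of_int_mult pderiv_X) simp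
      have "pderiv (pderiv G) = H * pderiv (pderiv F) + of_int 2 * of_int M * pderiv F"
        unfolding G_def by (simp only: pderiv_mult pderiv_add dH pderiv_of_int_mult pderiv_of_int) (simp add: algebra_simps)
      also have "\<dots> \<in> P"
        by (rule ideal2_add[OF ideal2_mult'[OF HP] ideal2_mult[OF pderiv_P2[OF FP2]]])
      finally have ddG: "pderiv (pderiv G) \<in> P" .
      have "pderiv L = of_int (M * (int n + 1))"
        unfolding L_def by (simp only: pderiv_add pderiv_of_int pderiv_of_int_mult pderiv_X mult_1_right add_0_right)
      then have "X ^ (n - 1) * of_int (M * (int n + 1)) = pderiv (pderiv G) - pderiv (X ^ (n - 1)) * L"
        unfolding dG by (simp only: pderiv_mult) (simp add: algebra_simps)
      also have "\<dots> \<in> P" using ddG LP by (intro ideal2_diff ideal2_mult)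
      finally have "p dvd M * (int n + 1)" using prime_mult power_P XP of_int_P by blast
      then show False using p m False by (simp add: M_def prime_dvd_mult_iff prime_dvd_power_iff)
    qed
  qed
qed

end

text \<open>Passing from D to d removes only primes dividing b m, so the p-part of D survives in d
  for every other p.\<close>

lemma not_square_dvd_D_quot:
  assumes sq: "squarefree (d_quot n b m)" and p: "prime p" "\<not> p dvd b * m" and bm: "b * m \<noteq> 0"
  shows "\<not> p\<^sup>2 dvd D_quot n b m"
proof
  assume dvd: "p\<^sup>2 dvd D_quot n b m"
  define E where "E = (\<Prod>q\<in>prime_factors (b * m). q ^ multiplicity q (D_quot n b m))"
  have "E dvd \<bar>D_quot n b m\<bar>" unfolding E_def by (rule prime_part_dvd)
  then have eq: "\<bar>D_quot n b m\<bar> = E * d_quot n b m" by (simp add: d_quot_def E_def)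
  have "coprime p E"
    unfolding E_def
  proof (rule prod_coprime_right)
    fix q assume q: "q \<in> prime_factors (b * m)"
    then have "coprime p q" using p by (intro primes_coprime) auto
    then show "coprime p (q ^ multiplicity q (D_quot n b m))" by simp
  qed
  then have "coprime (p\<^sup>2) E" by simp
  moreover have "p\<^sup>2 dvd E * d_quot n b m" using dvd by (simp flip: eq)
  ultimately have "p\<^sup>2 dvd d_quot n b m" by (simp add: coprime_dvd_mult_right_iff)
  then have "is_unit p" using sq by (auto dest: squarefreeD)
  with p(1) show False using not_prime_unit by blast
qed

lemma F_poly_not_maximal:
  assumes root: "eval_int \<theta> (F_poly n b m) = 0"
    and irr: "irreducible (map_poly rat_of_int (F_poly n b m))"
    and p: "prime p" and n: "n > 0" "p dvd n" and m: "int p dvd m" and sq: "(int p)\<^sup>2 dvd (- b) ^ p + b"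
  shows "\<not> ring_of_integers (rat_adjoin \<theta>) \<subseteq> range (eval_int \<theta>)"
proof
  assume sub: "ring_of_integers (rat_adjoin \<theta>) \<subseteq> range (eval_int \<theta>)"
  define F where "F = F_poly n b m"
  interpret integral_generator F \<theta>
    by unfold_locales (use root irr lead_coeff_F_poly in \<open>simp_all add: F_def\<close>)
  obtain t where t: "n = p * t" using n(2) by blast
  \<comment> \<open>With p = r + 2, the powers s^(p-1) and s^(p-2) are \<open>s ^ Suc r\<close> and
    \<open>s ^ r\<close>.\<close>
  obtain r where r: "p = Suc (Suc r)" using prime_ge_2_nat[OF p] by (metis add_2_eq_Suc le_Suc_ex)
  have t0: "t > 0" using n(1) t by simp
  define s where "s = X ^ t + of_int b"
  obtain g where g: "F = X ^ n + of_int b + of_int (b * m\<^sup>2) * X * g"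
    unfolding F_def by (rule F_poly_const[OF n(1)])
  obtain B where B: "(s + of_int (- b)) ^ p = s ^ p + of_int (- b) ^ p + of_nat p * s * of_int (- b) * B"
    by (rule freshman_prime[OF p])
  obtain k where k: "(- b) ^ p + b = (int p)\<^sup>2 * k" using sq by blast
  have "(int p)\<^sup>2 dvd b * m\<^sup>2" using m by (intro dvd_mult dvd_power_same)
  then obtain l where l: "b * m\<^sup>2 = (int p)\<^sup>2 * l" by blast
  have "X ^ n = (X ^ t) ^ p" by (simp only: t mult.commute[of p t] power_mult)
  then have Xn: "X ^ n = (s + of_int (- b)) ^ p" by (simp add: s_def)
  have bk: "of_int (- b) ^ p + of_int b = (of_int (int p))\<^sup>2 * (of_int k :: int poly)"
    using arg_cong[OF k, of "of_int :: int \<Rightarrow> int poly"] by (simp only: of_int_add of_int_mult of_int_power)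
  define A where "A = of_int (- b) * B"
  define C where "C = of_int k + of_int l * X * g"
  have F: "F = s ^ p + of_int (int p) * s * A + (of_int (int p))\<^sup>2 * C"
  proof -
    have "F = s ^ p + of_nat p * s * of_int (- b) * B + (of_int (- b) ^ p + of_int b)
        + of_int (b * m\<^sup>2) * X * g"
      unfolding g Xn B by (simp add: algebra_simps)
    also have "\<dots> = s ^ p + of_int (int p) * s * A + (of_int (int p))\<^sup>2 * C"
      unfolding bk l A_def C_def by (simp add: algebra_simps)
    finally show ?thesis .
  qed
  define S where "S = eval_int \<theta> s"
  \<comment> \<open>$F = s^p + p s A + p^2 C$ makes $w = s^{p-1}/p$ a root of $w^2 + A w + s^{p-2} C$.\<close>
  define w where "w = S ^ Suc r / of_nat p"
  have p0: "(of_nat p :: complex) \<noteq> 0" using prime_gt_0_nat[OF p] by simp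
  have S: "S ^ p + of_nat p * S * eval_int \<theta> A + (of_nat p)\<^sup>2 * eval_int \<theta> C = 0"
    using root'[unfolded map_poly_of_rat_of_int] unfolding F eval_int_simps S_def by simp
  have pw: "of_nat p * w = S ^ Suc r" using p0 by (simp add: w_def)
  have "w\<^sup>2 + eval_int \<theta> A * w + eval_int \<theta> (s ^ r * C) = 0"
  proof -
    \<comment> \<open>Multiplied by p^2, the quadratic equation becomes s^(p-2) F evaluated at
      \<theta>.\<close>
    have "(of_nat p)\<^sup>2 * (w\<^sup>2 + eval_int \<theta> A * w + eval_int \<theta> (s ^ r * C))
       = (of_nat p * w)\<^sup>2 + of_nat p * eval_int \<theta> A * (of_nat p * w) + (of_nat p)\<^sup>2 * (S ^ r * eval_int \<theta> C)"
      unfolding eval_int_simps S_def by (simp add: algebra_simps power2_eq_square)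
    also have "\<dots> = S ^ r * (S ^ p + of_nat p * S * eval_int \<theta> A + (of_nat p)\<^sup>2 * eval_int \<theta> C)"
      unfolding pw by (subst (3) r) (simp add: algebra_simps power2_eq_square)
    also have "\<dots> = 0" unfolding S by simp
    finally show ?thesis using p0 by simp
  qed
  then have "algebraic_int w"
    by (rule algebraic_int_quadratic[OF monic degree_pos root[folded F_def]])
  moreover have "w \<in> rat_adjoin \<theta>"
  proof -
    have "w = of_rat (1 / of_nat p) * eval_int \<theta> (s ^ Suc r)"
      unfolding eval_int_simps w_def S_def by (simp add: of_rat_divide)
    then show ?thesis by (simp only: rat_adjoin.mult rat_adjoin.rat eval_int_rat_adjoin)
  qed
  ultimately have "w \<in> range (eval_int \<theta>)" using sub by (auto simp: ring_of_integers_def)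
  then obtain h where h: "w = eval_int \<theta> h" by blast
  obtain q h' where h': "h = F * q + h'" "h' = 0 \<or> degree h' < degree F"
    using monic_division[OF monic] .
  have degF: "degree F = n" by (simp add: F_def degree_F_poly)
  have degs: "degree s = t" and lcs: "lead_coeff s = 1"
  proof -
    have s_eq: "s = monom 1 t + [:b:]" using of_int_mult_X_power[of 1 t] by (simp add: s_def of_int_poly)
    show "degree s = t" unfolding s_eq using t0 by (simp add: degree_add_eq_left degree_monom_eq)
    then show "lead_coeff s = 1" using t0 by (simp add: s_eq coeff_pCons split: nat.splits)
  qed
  have lcp: "lead_coeff (s ^ Suc r) = 1" using lcs by (simp add: lead_coeff_power lead_coeff_mult)
  have "s \<noteq> 0" using lcs by auto
  from degree_power_eq[OF this, of "Suc r"] have "degree (s ^ Suc r) = Suc r * t" by (simp only: degs mult_ac)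
  then have d1: "degree (s ^ Suc r) < degree F" using t0 by (simp add: degF t r)
  have d2: "degree (of_int (int p) * h') < degree F"
    using h'(2) r degree_of_int_mult[of "int p" h'] degree_pos by auto
  \<comment> \<open>If w were in Z[\<theta>], then s^(p-1) and p h' would agree at \<theta>; both
    have degree below n, so they would be equal, but s^(p-1) is monic.\<close>
  have "eval_int \<theta> (s ^ Suc r - of_int (int p) * h') = 0"
  proof -
    have "eval_int \<theta> h = eval_int \<theta> h'"
      using root[folded F_def] unfolding h'(1) eval_int_simps by simp
    then have "of_nat p * eval_int \<theta> h' = S ^ Suc r" using pw h by simp
    then show ?thesis unfolding eval_int_simps S_def by simp
  qed
  moreover have "degree (s ^ Suc r - of_int (int p) * h') < degree F"
    using d1 d2 by (rule degree_diff_less)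
  ultimately have "s ^ Suc r - of_int (int p) * h' = 0" by (rule eval_int_eq_0_imp)
  then have "of_int (int p) dvd s ^ Suc r" by simp
  then have "int p dvd lead_coeff (s ^ Suc r)" by (simp only: of_int_dvd_poly_iff)
  then show False using lcp r by simp
qed

text \<open>The integer is -b (b^(p-1) - 1) for odd p but b (b + 1) for p = 2, and b is prime to p.
  This sign is why being a Wieferich prime is an obstruction at odd p and a requirement at
  2.\<close>

lemma square_dvd_neg_power_add_iff:
  assumes p: "prime p" and m: "int p dvd m" and bm: "gcd b m = 1"
  shows "(int p)\<^sup>2 dvd (- b) ^ p + b \<longleftrightarrow> (if odd p then wieferich_prime b p else \<not> [b = 1] (mod 4))"
proof -
  have "\<not> int p dvd b"
  proof
    assume "int p dvd b"
    then have "int p dvd 1" using m bm by (metis gcd_greatest)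
    then show False using p by simp
  qed
  then have cop: "coprime (int p) b" using p by (intro prime_imp_coprime) simp_all
  show ?thesis
  proof (cases "odd p")
    case True
    then have "(- b) ^ p + b = - (b * (b ^ (p - 1) - 1))"
      by (cases p) (simp_all add: algebra_simps)
    moreover have "coprime ((int p)\<^sup>2) b" using cop by simp
    ultimately show ?thesis using True p
      by (simp add: wieferich_prime_def cong_iff_dvd_diff coprime_dvd_mult_right_iff)
  next
    case False
    then have p2: "p = 2" using p primes_dvd_imp_eq two_is_prime_nat by blast
    have "odd b" using \<open>\<not> int p dvd b\<close> by (simp add: p2)
    then have "coprime (4 :: int) b" using cop by (simp add: p2 flip: coprime_power_left_iff[of 2 2 b, simplified])
    moreover have "(- b) ^ 2 + b = b * (b + 1)" by (simp add: power2_eq_square algebra_simps)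
    ultimately have "(int p)\<^sup>2 dvd (- b) ^ p + b \<longleftrightarrow> 4 dvd b + 1"
      by (simp add: p2 coprime_dvd_mult_right_iff)
    also have "\<dots> \<longleftrightarrow> \<not> [b = 1] (mod 4)"
      using \<open>odd b\<close> unfolding cong_iff_dvd_diff by presburger
    finally show ?thesis using False by simp
  qed
qed

theorem theorem1p3:
  fixes n :: nat and m b :: int
  assumes "n \<ge> 3" and "\<bar>m\<bar> \<ge> 2" and "b \<ge> 2"
    and "gcd b m = 1" and "squarefree b"
    and "squarefree (d_quot n b m)"
  shows "monogenic (F_poly n b m) \<longleftrightarrow>
    (\<forall>p::nat. prime p \<and> odd p \<and> int p dvd gcd (int n) m \<longrightarrow> \<not> wieferich_prime b p) \<and>
    ([gcd (int n) m = 0] (mod 2) \<longrightarrow> [b = 1] (mod 4))"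
proof -
  let ?F = "F_poly n b m"
  let ?cond = "\<forall>p::nat. prime p \<longrightarrow> int p dvd int n \<longrightarrow> int p dvd m \<longrightarrow> \<not> (int p)\<^sup>2 dvd (- b) ^ p + b"
  have n0: "n > 0" using assms(1) by simp
  have irr: "irreducible (map_poly rat_of_int ?F)"
    by (rule irreducible_F_poly[OF n0 assms(3,5)])
  have gen: "integral_generator ?F \<theta>" if "eval_int \<theta> ?F = 0" for \<theta>
    by unfold_locales (use that irr lead_coeff_F_poly in auto)
  have basis: "monogenic ?F \<longleftrightarrow>
     (\<forall>\<theta>. eval_int \<theta> ?F = 0 \<longrightarrow> ring_of_integers (rat_adjoin \<theta>) \<subseteq> range (eval_int \<theta>))"
    unfolding monogenic_def
    using irr lead_coeff_F_poly integral_generator.is_int_basis_iff[OF gen] by auto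
  have "monogenic ?F \<longleftrightarrow> ?cond"
  proof
    assume mono: "monogenic ?F"
    have "degree (map_poly of_int ?F :: complex poly) = n"
      by (simp add: degree_F_poly)
    \<comment> \<open>\<open>monogenic\<close> quantifies over all roots, so this direction needs an
      actual one.\<close>
    then obtain \<theta> where root: "eval_int \<theta> ?F = 0"
      using n0 fundamental_theorem_of_algebra[of "map_poly of_int ?F"]
      by (metis constant_degree neq0_conv)
    have "ring_of_integers (rat_adjoin \<theta>) \<subseteq> range (eval_int \<theta>)"
      using mono root unfolding basis by blast
    then show ?cond
      using F_poly_not_maximal[OF root irr _ n0] by (metis int_dvd_int_iff)
  next
    assume cond: ?cond
    show "monogenic ?F"
      unfolding basis
    proof (intro allI impI)
      fix \<theta> assume "eval_int \<theta> ?F = 0"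
      then interpret integral_generator ?F \<theta> by (rule gen)
      show "ring_of_integers (rat_adjoin \<theta>) \<subseteq> range (eval_int \<theta>)"
      proof (rule ring_of_integers_subset)
        fix p :: int and \<pi> :: "int poly" assume p: "prime p" and "lead_coeff \<pi> = 1" "prime_ideal2 (of_int p) \<pi>"
        then interpret prime_over p \<pi> by unfold_locales
        consider "p dvd b" | "\<not> p dvd b" "p dvd m" | "\<not> p dvd b" "\<not> p dvd m" by blast
        then show "?F \<notin> ideal2_sq (of_int p) \<pi>"
        proof cases
          case 1
          have "\<not> p\<^sup>2 dvd b" using assms(5) p not_prime_unit by (auto dest: squarefreeD)
          with 1 show ?thesis using assms(1) by (intro F_poly_regular_dvd_b) auto
        next
          case 2
          have "prime (nat p)" "p = int (nat p)" using p by (simp_all add: prime_ge_0_int)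
          then have "\<not> p\<^sup>2 dvd (- b) ^ nat p + b" if "p dvd int n"
            using cond that 2(2) by metis
          with 2 show ?thesis using assms(1,3) by (intro F_poly_regular_dvd_m) auto
        next
          case 3
          have "b * m \<noteq> 0" using assms(2,3) by auto
          moreover have "\<not> p dvd b * m" using 3 p by (simp add: prime_dvd_mult_iff)
          ultimately have "\<not> p\<^sup>2 dvd D_quot n b m"
            using not_square_dvd_D_quot[OF assms(6) p] by blast
          with 3 show ?thesis using assms(1,3) by (intro F_poly_regular_coprime) auto
        qed
      qed
    qed
  qed
  also have "?cond \<longleftrightarrow> (\<forall>p::nat. prime p \<longrightarrow> int p dvd gcd (int n) m \<longrightarrow>
      \<not> (if odd p then wieferich_prime b p else \<not> [b = 1] (mod 4)))"
    using square_dvd_neg_power_add_iff[OF _ _ assms(4)] by (metis gcd_greatest_iff)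
  also have "\<dots> \<longleftrightarrow> (\<forall>p::nat. prime p \<and> odd p \<and> int p dvd gcd (int n) m \<longrightarrow> \<not> wieferich_prime b p) \<and>
    ([gcd (int n) m = 0] (mod 2) \<longrightarrow> [b = 1] (mod 4))"
  proof -
    have "p = 2" if "prime p" "even p" for p :: nat
      using that primes_dvd_imp_eq two_is_prime_nat by blast
    moreover have "[gcd (int n) m = 0] (mod 2) \<longleftrightarrow> int 2 dvd gcd (int n) m"
      by (simp add: cong_0_iff)
    ultimately show ?thesis using two_is_prime_nat by (smt (verit) even_numeral)
  qed
  finally show ?thesis .
qed

end
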